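(* Let $\lambda$ be a partition and $k\ge 0$. Let $b_j(\lambda)$, $j\ge 1$, be the Boolean cumulants of the transition measure of $\lambda$, and let $\hat m_k(\lambda)$ be the $k$-th moment of the co-transition measure of $\lambda$. Then $b_1(\lambda)=0$ and $$b_{k+2}(\lambda)=|\lambda|\,\hat m_k(\lambda).$$
   Context: The content of the cell in row $i$, column $j$ of a Young diagram is $j-i$. For $\lambda\vdash n=|\lambda|$, $L^\lambda$ denotes the simple $\mathbb C[S_n]$-module indexed by $\lambda$. Let $x_1<\dots<x_d$ be the contents of the cells that can be added to $\lambda$ (so that the result is a Young diagram), and $y_1<\dots<y_{d-1}$ the contents of the cells that can be removed from $\lambda$; let $\lambda^{(i)}$ be $\lambda$ with the addable cell of content $x_i$ added, and $\lambda_{(i)}$ be $\lambda$ with the removable cell of content $y_i$ removed. The transition measure of $\lambda$ is the probability measure $\sum_{i=1}^d\frac{\dim L^{\lambda^{(i)}}}{(n+1)\dim L^\lambda}\delta_{x_i}$ on $\mathbb R$, with moments $m_k(\lambda)=\sum_{i=1}^d x_i^k\frac{\dim L^{\lambda^{(i)}}}{(n+1)\dim L^\lambda}$. The co-transition measure of $\lambda$ is $\sum_{i=1}^{d-1}\frac{\dim L^{\lambda_{(i)}}}{\dim L^\lambda}\delta_{y_i}$, with moments $\hat m_k(\lambda)=\sum_{i=1}^{d-1}y_i^k\frac{\dim L^{\lambda_{(i)}}}{\dim L^\lambda}$ (with $0^0=1$). The Boolean cumulants $b_k(\lambda)$, $k\ge1$, of the transition measure are defined by the identity of formal series in $z^{-1}$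 $$z-\sum_{k=-1}^\infty b_{k+2}(\lambda)z^{-k-1}=\Big(\sum_{k=0}^\infty m_k(\lambda)z^{-k-1}\Big)^{-1}.$$ *)

theory Defs
  imports
    Complex_Main
    "HOL-Library.Function_Algebras"
    "HOL-Combinatorics.Permutations"
    "HOL-Computational_Algebra.Formal_Laurent_Series"
begin

section \<open>Partitions and Young diagrams\<close>

definition is_partition :: "nat list \<Rightarrow> bool" where
  "is_partition lam \<longleftrightarrow> sorted_wrt (\<ge>) lam \<and> 0 \<notin> set lam"

text \<open>Cells are pairs (row, column), both counted from 0; contents are not affected by the shift.\<close>

definition cells :: "nat list \<Rightarrow> (nat \<times> nat) set" where
  "cells lam = {(i, j). i < length lam \<and> j < lam ! i}"

definition young_diagram :: "(nat \<times> nat) set \<Rightarrow> bool" where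
  "young_diagram D \<longleftrightarrow> (\<exists>lam. is_partition lam \<and> D = cells lam)"

definition content :: "nat \<times> nat \<Rightarrow> int" where
  "content c = int (snd c) - int (fst c)"

definition addable :: "(nat \<times> nat) set \<Rightarrow> (nat \<times> nat) set" where
  "addable D = {c. c \<notin> D \<and> young_diagram (insert c D)}"

definition removable :: "(nat \<times> nat) set \<Rightarrow> (nat \<times> nat) set" where
  "removable D = {c \<in> D. young_diagram (D - {c})}"


section \<open>The simple modules of the symmetric group\<close>

text \<open>
  The simple module indexed by a partition is realised as its Specht module: the complex span of
  the polytabloids in the permutation module on tabloids. With n the number of cells, the symmetric
  group consists of the permutations of \<open>{1..n}\<close>, acting by composition on tableaux
  (which are 0 outside the diagram, a value fixed by these permutations). Elements of the
  permutation module are complex-valued functions on tabloids.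
\<close>

definition tableaux :: "(nat \<times> nat) set \<Rightarrow> (nat \<times> nat \<Rightarrow> nat) set" where
  "tableaux D = {T. bij_betw T D {1..card D} \<and> (\<forall>c. c \<notin> D \<longrightarrow> T c = 0)}"

text \<open>The tabloid of T is the set of all tableaux with the same set of entries in every row.\<close>

definition tabloid ::
    "(nat \<times> nat) set \<Rightarrow> (nat \<times> nat \<Rightarrow> nat) \<Rightarrow> (nat \<times> nat \<Rightarrow> nat) set" where
  "tabloid D T =
    {T' \<in> tableaux D. \<forall>i. T' ` {c \<in> D. fst c = i} = T ` {c \<in> D. fst c = i}}"

definition column_stabilizer ::
    "(nat \<times> nat) set \<Rightarrow> (nat \<times> nat \<Rightarrow> nat) \<Rightarrow> (nat \<Rightarrow> nat) set" where
  "column_stabilizer D T =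
    {p. p permutes {1..card D} \<and>
        (\<forall>j. p ` T ` {c \<in> D. snd c = j} = T ` {c \<in> D. snd c = j})}"

definition polytabloid ::
    "(nat \<times> nat) set \<Rightarrow> (nat \<times> nat \<Rightarrow> nat) \<Rightarrow> (nat \<times> nat \<Rightarrow> nat) set \<Rightarrow> complex" where
  "polytabloid D T =
    (\<lambda>X. \<Sum>p\<in>column_stabilizer D T. if X = tabloid D (p \<circ> T) then of_int (sign p) else 0)"

interpretation cfun: vector_space "\<lambda>(c::complex) (f :: 'a \<Rightarrow> complex) x. c * f x"
  by unfold_locales (auto simp: fun_eq_iff algebra_simps)

definition specht_module ::
    "(nat \<times> nat) set \<Rightarrow> ((nat \<times> nat \<Rightarrow> nat) set \<Rightarrow> complex) set" where
  "specht_module D = cfun.span (polytabloid D ` tableaux D)"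

definition dim_L :: "(nat \<times> nat) set \<Rightarrow> nat" where
  "dim_L D = cfun.dim (specht_module D)"


section \<open>Transition and co-transition measures\<close>

text \<open>
  Distinct addable (removable) cells have distinct contents, so the sums over contents are
  written as sums over cells.
\<close>

definition transition_moment :: "(nat \<times> nat) set \<Rightarrow> nat \<Rightarrow> real" where
  "transition_moment D k =
    (\<Sum>c\<in>addable D. of_int (content c) ^ k *
      (real (dim_L (insert c D)) / ((real (card D) + 1) * real (dim_L D))))"

definition cotransition_moment :: "(nat \<times> nat) set \<Rightarrow> nat \<Rightarrow> real" where
  "cotransition_moment D k =
    (\<Sum>c\<in>removable D. of_int (content c) ^ k * (real (dim_L (D - {c})) / real (dim_L D)))"


section \<open>Boolean cumulants\<close>

text \<open>
  The defining identity, as an identity of formal Laurent series in the variable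
  \<^term>\<open>fls_X\<close>, which stands for \<open>z\<^sup>-\<^sup>1\<close>. The summation index on the left is shifted by one.
  Boolean cumulants are indexed from 1; the value at 0 is pinned to 0 by convention.
\<close>

definition is_boolean_cumulants :: "(nat \<Rightarrow> real) \<Rightarrow> (nat \<Rightarrow> real) \<Rightarrow> bool" where
  "is_boolean_cumulants m b \<longleftrightarrow> b 0 = 0 \<and>
    fls_X_inv - fps_to_fls (Abs_fps (\<lambda>k. b (k + 1)))
      = inverse (fls_X * fps_to_fls (Abs_fps m))"

definition boolean_cumulant :: "(nat \<Rightarrow> real) \<Rightarrow> nat \<Rightarrow> real" where
  "boolean_cumulant m = (THE b. is_boolean_cumulants m b)"

lemma boolean_cumulants_ex1:
  assumes "m 0 = 1"
  shows "\<exists>!b. is_boolean_cumulants m b"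
proof -
  define g where "g = inverse (Abs_fps m)"
  have g0: "fps_nth g 0 = 1" using assms by (simp add: g_def)
  have sd: "subdegree (Abs_fps m) = 0"
    using assms by (simp add: subdegree_eq_0_iff)
  have inv: "inverse (fls_X * fps_to_fls (Abs_fps m)) = fls_X_inv * fps_to_fls g"
    by (simp add: fls_inverse_X fls_inverse_fps_to_fls[OF sd] g_def inverse_mult_distrib)
  have g: "g = 1 + fps_X * fps_shift 1 g"
    using g0 by (auto simp: fps_eq_iff fps_X_mult_nth)
  have "fps_to_fls g = 1 + fls_X * fps_to_fls (fps_shift 1 g)"
    by (subst g) (simp add: fps_to_fls_plus fls_times_fps_to_fls)
  then have "fls_X_inv * fps_to_fls g
      = fls_X_inv + (fls_X_inv * fls_X) * fps_to_fls (fps_shift 1 g)"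
    by (simp add: algebra_simps)
  also have "(fls_X_inv * fls_X :: real fls) = 1"
    by (simp flip: fls_inverse_X)
  finally have "inverse (fls_X * fps_to_fls (Abs_fps m)) = fls_X_inv + fps_to_fls (fps_shift 1 g)"
    using inv by simp
  then have iff: "is_boolean_cumulants m b \<longleftrightarrow>
      b 0 = 0 \<and> - fps_to_fls (Abs_fps (\<lambda>k. b (k + 1))) = fps_to_fls (fps_shift 1 g)" for b
    unfolding is_boolean_cumulants_def by (simp only: diff_conv_add_uminus add_left_cancel)
  have iff': "is_boolean_cumulants m b \<longleftrightarrow> b 0 = 0 \<and> (\<forall>k. b (Suc k) = - fps_nth g (Suc k))" for b
  proof -
    have "- fps_to_fls (Abs_fps (\<lambda>k. b (k + 1))) = fps_to_fls (fps_shift 1 g)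
        \<longleftrightarrow> fps_to_fls (- Abs_fps (\<lambda>k. b (k + 1))) = fps_to_fls (fps_shift 1 g)"
      by simp
    also have "\<dots> \<longleftrightarrow> - Abs_fps (\<lambda>k. b (k + 1)) = fps_shift 1 g"
      by (simp only: fps_to_fls_eq_iff)
    also have "\<dots> \<longleftrightarrow> (\<forall>k. b (Suc k) = - fps_nth g (Suc k))"
      by (simp add: fps_eq_iff) (metis minus_minus)
    finally show ?thesis using iff by simp
  qed
  show ?thesis
  proof (rule ex1I)
    show "is_boolean_cumulants m (\<lambda>k. if k = 0 then 0 else - fps_nth g k)"
      by (simp add: iff')
  next
    fix b assume "is_boolean_cumulants m b"
    then show "b = (\<lambda>k. if k = 0 then 0 else - fps_nth g k)"
      unfolding iff' by (metis not0_implies_Suc)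
  qed
qed

end

theory Submission
  imports Defs
begin

text \<open>
  Standard polytabloids form a basis of the Specht module (independence by a triangularity argument,
  spanning by the Garnir relations), so \<open>dim L\<close> satisfies the branching recurrence and is
  given by the Frobenius formula. Hence the ratios \<open>dim L\<^bsup>\<lambda>\<plusminus>box\<^esup> / dim L\<^bsup>\<lambda>\<^esup>\<close> are explicit products of
  differences of shifted row lengths. With \<open>G\<close> the Cauchy transform of the transition measure and
  \<open>q\<^sub>j\<close> the co-transition weights, the claim is \<open>(z - \<Sum>\<^sub>j n q\<^sub>j / (z - y\<^sub>j)) G(z) = 1\<close>. The left-hand
  side tends to 1 at infinity, and that its residues at the \<open>x\<^sub>i\<close> and \<open>y\<^sub>j\<close> vanish is Lagrange
  interpolation in the shifted row lengths.
\<close>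

section \<open>Tableaux and polytabloids\<close>

text \<open>Both measures are sums over corners, whereas interpolation needs all shifted row lengths
  as nodes. The gap closes by itself: \<open>up_ratio\<close> and \<open>down_ratio\<close> vanish
  at rows that cannot grow or shrink, so either measure may be summed over all of the first
  \<open>r\<close> rows. The number \<open>r\<close> is free, and padding by empty rows serves two
  ends: the cell that opens a new row becomes the corner of an ordinary row, and the node of value 0
  cancels the factor \<open>x i + 1\<close> in the denominator of \<open>up_ratio\<close>. Contents
  of addable and removable cells are shifted row lengths minus \<open>r - 1\<close> and minus
  \<open>r\<close>, so every difference of contents has the form \<open>x i + 1 - x j\<close>.
  Branching is used only for removal. That the transition weights sum to 1 comes from interpolation,
  not from a second branching rule. No analytic function appears either: the vanishing residues are
  turned into a recurrence for the moments, and the cumulants are read off from that as from a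
  product of formal series.\<close>

definition col_increasing :: "(nat \<times> nat) set \<Rightarrow> (nat \<times> nat \<Rightarrow> nat) \<Rightarrow> bool" where
  "col_increasing D T \<longleftrightarrow>
    (\<forall>i i' j. (i, j) \<in> D \<longrightarrow> (i', j) \<in> D \<longrightarrow> i < i' \<longrightarrow> T (i, j) < T (i', j))"

definition row_increasing :: "(nat \<times> nat) set \<Rightarrow> (nat \<times> nat \<Rightarrow> nat) \<Rightarrow> bool" where
  "row_increasing D T \<longleftrightarrow>
    (\<forall>i j j'. (i, j) \<in> D \<longrightarrow> (i, j') \<in> D \<longrightarrow> j < j' \<longrightarrow> T (i, j) < T (i, j'))"

definition std_tableaux :: "(nat \<times> nat) set \<Rightarrow> (nat \<times> nat \<Rightarrow> nat) set" where
  "std_tableaux D = {T \<in> tableaux D. row_increasing D T \<and> col_increasing D T}"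

lemma tableaux_inj_on: "T \<in> tableaux D \<Longrightarrow> inj_on T D"
  by (simp add: tableaux_def bij_betw_def)

lemma tableaux_image: "T \<in> tableaux D \<Longrightarrow> T ` D = {1..card D}"
  by (simp add: tableaux_def bij_betw_def)

lemma tableaux_eq_iff:
  "T \<in> tableaux D \<Longrightarrow> c \<in> D \<Longrightarrow> c' \<in> D \<Longrightarrow> T c = T c' \<longleftrightarrow> c = c'"
  using tableaux_inj_on by (metis inj_on_eq_iff)

lemma tableaux_comp:
  assumes "T \<in> tableaux D" "p permutes {1..card D}"
  shows "p \<circ> T \<in> tableaux D"
proof -
  have "bij_betw (p \<circ> T) D {1..card D}"
    using assms bij_betw_trans permutes_imp_bij unfolding tableaux_def by blast
  moreover have "p 0 = 0"
    using assms(2) by (simp add: permutes_not_in)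
  ultimately show ?thesis
    using assms(1) by (simp add: tableaux_def)
qed

lemma finite_tableaux:
  assumes "finite D"
  shows "finite (tableaux D)"
proof (rule finite_subset)
  show "tableaux D \<subseteq> {T. \<forall>c. (c \<in> D \<longrightarrow> T c \<in> {1..card D}) \<and> (c \<notin> D \<longrightarrow> T c = 0)}"
    unfolding tableaux_def bij_betw_def by auto
  show "finite {T. \<forall>c. (c \<in> D \<longrightarrow> T c \<in> {1..card D}) \<and> (c \<notin> D \<longrightarrow> T c = 0)}"
    using assms by (intro finite_set_of_finite_funs) auto
qed

lemma finite_std_tableaux: "finite D \<Longrightarrow> finite (std_tableaux D)"
  unfolding std_tableaux_def using finite_tableaux by auto

lemma tabloid_eq_iff:
  assumes "S \<in> tableaux D" "T \<in> tableaux D"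
  shows "tabloid D S = tabloid D T \<longleftrightarrow>
    (\<forall>i. S ` {c \<in> D. fst c = i} = T ` {c \<in> D. fst c = i})"
proof
  assume "tabloid D S = tabloid D T"
  moreover have "S \<in> tabloid D S"
    using assms by (simp add: tabloid_def)
  ultimately show "\<forall>i. S ` {c \<in> D. fst c = i} = T ` {c \<in> D. fst c = i}"
    by (simp add: tabloid_def)
qed (simp add: tabloid_def)

section \<open>Column stabilizers and the signs they produce\<close>

lemma finite_column_stabilizer: "finite (column_stabilizer D T)"
  unfolding column_stabilizer_def by (rule finite_subset[OF _ finite_permutations]) auto

lemma id_column_stabilizer: "id \<in> column_stabilizer D T"
  by (simp add: column_stabilizer_def permutes_id)

lemma column_stabilizerD:
  "p \<in> column_stabilizer D T \<Longrightarrow> p permutes {1..card D}"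
  "p \<in> column_stabilizer D T \<Longrightarrow> p ` T ` {c \<in> D. snd c = j} = T ` {c \<in> D. snd c = j}"
  by (auto simp: column_stabilizer_def)

lemma column_stabilizer_comp:
  assumes "p \<in> column_stabilizer D T" "q \<in> column_stabilizer D T"
  shows "p \<circ> q \<in> column_stabilizer D T"
proof -
  have "(p \<circ> q) ` T ` {c \<in> D. snd c = j} = T ` {c \<in> D. snd c = j}" for j
    using column_stabilizerD(2)[OF assms(1)] column_stabilizerD(2)[OF assms(2)]
    by (metis image_comp)
  with column_stabilizerD(1)[OF assms(1)] column_stabilizerD(1)[OF assms(2)] show ?thesis
    by (simp add: column_stabilizer_def permutes_compose)
qed

lemma column_stabilizer_inv:
  assumes "p \<in> column_stabilizer D T"
  shows "inv p \<in> column_stabilizer D T"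
proof -
  have p: "p permutes {1..card D}" and im: "\<And>j. p ` T ` {c \<in> D. snd c = j} = T ` {c \<in> D. snd c = j}"
    using assms column_stabilizerD by auto
  have "inv p ` T ` {c \<in> D. snd c = j} = T ` {c \<in> D. snd c = j}" for j
    by (metis (no_types) im p permutes_inj image_inv_f_f)
  with permutes_inv[OF p] show ?thesis
    by (simp add: column_stabilizer_def)
qed

lemma bij_betw_column_stabilizer_left:
  assumes "p \<in> column_stabilizer D T"
  shows "bij_betw ((\<circ>) p) (column_stabilizer D T) (column_stabilizer D T)"
proof (rule bij_betw_byWitness[where f' = "(\<circ>) (inv p)"])
  have p: "p permutes {1..card D}"
    using assms column_stabilizerD by auto
  show "\<forall>q\<in>column_stabilizer D T. inv p \<circ> (p \<circ> q) = q"
    by (simp add: o_assoc permutes_inv_o(2)[OF p])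
  show "\<forall>q\<in>column_stabilizer D T. p \<circ> (inv p \<circ> q) = q"
    by (simp add: o_assoc permutes_inv_o(1)[OF p])
qed (use assms column_stabilizer_comp column_stabilizer_inv in auto)

lemma column_stabilizer_conj:
  assumes s: "s permutes {1..card D}" and p: "p \<in> column_stabilizer D T"
  shows "s \<circ> p \<circ> inv s \<in> column_stabilizer D (s \<circ> T)"
proof -
  have "(s \<circ> p \<circ> inv s) ` (s \<circ> T) ` {c \<in> D. snd c = j} = (s \<circ> T) ` {c \<in> D. snd c = j}" for j
  proof -
    have "(s \<circ> p \<circ> inv s) ` (s \<circ> T) ` {c \<in> D. snd c = j} = s ` p ` T ` {c \<in> D. snd c = j}"
      by (simp add: image_image permutes_inverses(2)[OF s])
    also have "\<dots> = (s \<circ> T) ` {c \<in> D. snd c = j}"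
      using column_stabilizerD(2)[OF p] by (simp add: image_comp)
    finally show ?thesis .
  qed
  moreover have "s \<circ> p \<circ> inv s permutes {1..card D}"
    using s column_stabilizerD(1)[OF p] by (intro permutes_compose permutes_inv)
  ultimately show ?thesis
    by (simp add: column_stabilizer_def)
qed

lemma permutes_atLeastAtMost_permutation: "p permutes {1..n::nat} \<Longrightarrow> permutation p"
  by (auto simp: permutation_permutes)

text \<open>The column stabilizer of \<open>s \<circ> T\<close> is the conjugate by \<open>s\<close>
  of that of \<open>T\<close>, and conjugation keeps signs. After this reindexing all polytabloids
  of a Garnir sum run over one and the same group.\<close>

lemma polytabloid_comp:
  assumes s: "s permutes {1..card D}"
  shows "polytabloid D (s \<circ> T) X =
    (\<Sum>p\<in>column_stabilizer D T. if X = tabloid D (s \<circ> p \<circ> T) then of_int (sign p) else 0)"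
proof -
  have bij: "bij_betw (\<lambda>p. s \<circ> p \<circ> inv s) (column_stabilizer D T) (column_stabilizer D (s \<circ> T))"
  proof (rule bij_betw_byWitness[where f' = "\<lambda>q. inv s \<circ> q \<circ> s"])
    show "\<forall>p\<in>column_stabilizer D T. inv s \<circ> (s \<circ> p \<circ> inv s) \<circ> s = p"
      by (simp add: fun_eq_iff permutes_inverses[OF s])
    show "\<forall>q\<in>column_stabilizer D (s \<circ> T). s \<circ> (inv s \<circ> q \<circ> s) \<circ> inv s = q"
      by (simp add: fun_eq_iff permutes_inverses[OF s])
    show "(\<lambda>p. s \<circ> p \<circ> inv s) ` column_stabilizer D T \<subseteq> column_stabilizer D (s \<circ> T)"
      using column_stabilizer_conj[OF s] by auto
    have "inv s \<circ> q \<circ> s \<in> column_stabilizer D T" if "q \<in> column_stabilizer D (s \<circ> T)" for q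
      using column_stabilizer_conj[OF permutes_inv[OF s] that] permutes_inv_inv[OF s]
      by (simp add: o_assoc permutes_inv_o(2)[OF s])
    then show "(\<lambda>q. inv s \<circ> q \<circ> s) ` column_stabilizer D (s \<circ> T) \<subseteq> column_stabilizer D T"
      by auto
  qed
  have "sign (s \<circ> p \<circ> inv s) = sign p" if "p \<in> column_stabilizer D T" for p
  proof -
    have *: "permutation s" "permutation p" "permutation (inv s)"
      using s column_stabilizerD(1)[OF that] permutes_inv permutes_atLeastAtMost_permutation by blast+
    then have "sign (s \<circ> p \<circ> inv s) = sign s * sign p * sign s"
      by (simp add: sign_compose permutation_compose sign_inverse)
    then show ?thesis
      by (simp add: sign_def)
  qed
  moreover have "s \<circ> p \<circ> inv s \<circ> (s \<circ> T) = s \<circ> p \<circ> T" for p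
    by (simp add: fun_eq_iff permutes_inverses[OF s])
  ultimately show ?thesis
    unfolding polytabloid_def sum.reindex_bij_betw[OF bij, symmetric]
    by (intro sum.cong) auto
qed

text \<open>Left multiplication by \<open>s\<close> permutes the column stabilizer and multiplies
  every sign by \<open>sign s\<close>. Hence straightening may sort the columns first.\<close>

lemma polytabloid_column_stabilizer:
  assumes s: "s \<in> column_stabilizer D T"
  shows "polytabloid D (s \<circ> T) X = of_int (sign s) * polytabloid D T X"
proof -
  have "sign p = sign s * sign (s \<circ> p)" if "p \<in> column_stabilizer D T" for p
    using sign_compose[OF permutes_atLeastAtMost_permutation[OF column_stabilizerD(1)[OF s]]
        permutes_atLeastAtMost_permutation[OF column_stabilizerD(1)[OF that]]]
    by (simp add: sign_def)
  then have "polytabloid D (s \<circ> T) X = (\<Sum>p\<in>column_stabilizer D T.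
      of_int (sign s) * (if X = tabloid D ((s \<circ> p) \<circ> T) then of_int (sign (s \<circ> p)) else 0))"
    unfolding polytabloid_comp[OF column_stabilizerD(1)[OF s]]
    by (intro sum.cong refl) (simp del: of_int_mult add: of_int_mult[symmetric])
  also have "\<dots> = (\<Sum>p\<in>column_stabilizer D T.
      of_int (sign s) * (if X = tabloid D (p \<circ> T) then of_int (sign p) else 0))"
    by (rule sum.reindex_bij_betw[OF bij_betw_column_stabilizer_left[OF s], where
        g = "\<lambda>p. of_int (sign s) * (if X = tabloid D (p \<circ> T) then of_int (sign p) else 0)"])
  also have "\<dots> = of_int (sign s) * polytabloid D T X"
    by (simp add: polytabloid_def sum_distrib_left)
  finally show ?thesis .
qed

text \<open>The transposition acts before \<open>s\<close>: it exchanges two entries of one row of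
  \<open>S\<close>, so every row keeps its set of entries.\<close>

lemma tabloid_comp_transpose:
  assumes S: "S \<in> tableaux D" and s: "s permutes {1..card D}"
    and c: "c \<in> D" "c' \<in> D" "fst c = fst c'"
  shows "tabloid D (s \<circ> transpose (S c) (S c') \<circ> S) = tabloid D (s \<circ> S)"
proof -
  let ?t = "transpose (S c) (S c')"
  have "?t ` S ` {d \<in> D. fst d = i} = S ` {d \<in> D. fst d = i}" for i
  proof (cases "i = fst c")
    case True
    with c show ?thesis
      by (intro transpose_image_eq) auto
  next
    case False
    have "S e \<notin> S ` {d \<in> D. fst d = i}" if "e \<in> D" "fst e \<noteq> i" for e
      using tableaux_eq_iff[OF S that(1)] that(2) by auto
    with False c have "S c \<notin> S ` {d \<in> D. fst d = i}" "S c' \<notin> S ` {d \<in> D. fst d = i}"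
      by metis+
    then show ?thesis
      by (intro transpose_image_eq) auto
  qed
  then have "(s \<circ> ?t \<circ> S) ` {d \<in> D. fst d = i} = (s \<circ> S) ` {d \<in> D. fst d = i}" for i
    by (metis image_comp)
  then show ?thesis
    by (simp add: tabloid_def)
qed

text \<open>
  Right multiplication by the transposition of two entries in a common row of \<open>p \<circ> T\<close> is a
  sign-reversing involution on the terms belonging to \<open>p\<close>.
\<close>

lemma garnir_relation:
  assumes T: "T \<in> tableaux D" and U: "U \<subseteq> {1..card D}"
    and row: "\<And>p. p \<in> column_stabilizer D T \<Longrightarrow>
      \<exists>c\<in>D. \<exists>c'\<in>D. c \<noteq> c' \<and> fst c = fst c' \<and> p (T c) \<in> U \<and> p (T c') \<in> U"
  shows "(\<Sum>s | s permutes U. of_int (sign s) * polytabloid D (s \<circ> T) X) = 0"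
proof -
  let ?C = "column_stabilizer D T"
  have fU: "finite U"
    using U finite_subset by blast
  have perm: "s permutes {1..card D}" if "s permutes U" for s
    using that U permutes_subset by blast
  have inner: "(\<Sum>s | s permutes U. of_int (sign s) * (if X = tabloid D (s \<circ> p \<circ> T) then 1 else 0)) = (0::complex)"
    (is "sum ?f _ = 0") if p: "p \<in> ?C" for p
  proof -
    obtain c c' where c: "c \<in> D" "c' \<in> D" "c \<noteq> c'" "fst c = fst c'" "p (T c) \<in> U" "p (T c') \<in> U"
      using row[OF p] by blast
    define t where "t = transpose (p (T c)) (p (T c'))"
    have pT: "p \<circ> T \<in> tableaux D"
      using tableaux_comp[OF T] column_stabilizerD(1)[OF p] by blast
    have ne: "p (T c) \<noteq> p (T c')"
      using tableaux_eq_iff[OF pT c(1,2)] c(3) by simp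
    have t: "t permutes U"
      unfolding t_def using c by (intro permutes_swap_id)
    have tt: "t \<circ> t = id"
      by (simp add: t_def)
    have bij: "bij_betw (\<lambda>s. s \<circ> t) {s. s permutes U} {s. s permutes U}"
      by (rule bij_betw_byWitness[where f' = "\<lambda>s. s \<circ> t"])
        (use permutes_compose[OF t] in \<open>auto simp: comp_assoc tt\<close>)
    have "?f (s \<circ> t) = - ?f s" if "s permutes U" for s
    proof -
      have "tabloid D (s \<circ> t \<circ> p \<circ> T) = tabloid D (s \<circ> p \<circ> T)"
        using tabloid_comp_transpose[OF pT perm[OF that] c(1,2,4)] by (simp add: t_def comp_assoc)
      moreover have "sign (s \<circ> t) = - sign s"
        using sign_compose[of s t] permutes_imp_permutation[OF fU that]
          permutes_imp_permutation[OF fU t] ne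
        by (simp add: t_def sign_swap_id)
      ultimately show ?thesis
        by simp
    qed
    then have "(\<Sum>s | s permutes U. ?f (s \<circ> t)) = - (\<Sum>s | s permutes U. ?f s)"
      by (simp flip: sum_negf)
    then show ?thesis
      using sum.reindex_bij_betw[OF bij, of ?f] by simp
  qed
  have "(\<Sum>s | s permutes U. of_int (sign s) * polytabloid D (s \<circ> T) X) =
    (\<Sum>s | s permutes U. \<Sum>p\<in>?C. of_int (sign p) *
      (of_int (sign s) * (if X = tabloid D (s \<circ> p \<circ> T) then 1 else 0)))"
    by (intro sum.cong refl) (simp add: polytabloid_comp[OF perm] sum_distrib_left if_distrib mult.commute cong: if_cong)
  also have "\<dots> = (\<Sum>p\<in>?C. of_int (sign p) *
      (\<Sum>s | s permutes U. of_int (sign s) * (if X = tabloid D (s \<circ> p \<circ> T) then 1 else 0)))"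
    unfolding sum_distrib_left by (rule sum.swap)
  also have "\<dots> = 0"
    by (simp only: inner mult_zero_right sum.neutral_const cong: sum.cong)
  finally show ?thesis .
qed


section \<open>Linear independence of standard polytabloids\<close>

text \<open>A numerical stand-in for the dominance order on tabloids: it grows when a larger entry
  trades places with a smaller one in a lower row.\<close>

definition row_weight :: "(nat \<times> nat) set \<Rightarrow> (nat \<times> nat \<Rightarrow> nat) \<Rightarrow> nat" where
  "row_weight D T = (\<Sum>c\<in>D. fst c * T c)"

text \<open>At the least point of disagreement the smaller of the two values would have to be taken
  by the other function at an earlier point, where both agree; the first function would then take it
  twice.\<close>

lemma strict_mono_on_image_unique:
  fixes f g :: "'a::wellorder \<Rightarrow> 'b::linorder"
  assumes f: "strict_mono_on R f" and g: "strict_mono_on R g" and im: "f ` R = g ` R"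
    and "x \<in> R"
  shows "f x = g x"
  using \<open>x \<in> R\<close>
proof (induction x rule: less_induct)
  case (less x)
  have False if h: "strict_mono_on R h" "strict_mono_on R k" "h ` R = k ` R"
    "\<And>y. y < x \<Longrightarrow> y \<in> R \<Longrightarrow> h y = k y" "h x < k x" for h k :: "'a \<Rightarrow> 'b"
  proof -
    obtain y where y: "y \<in> R" "h x = k y"
      using h(3) less.prems by blast
    then have "k y < k x"
      using h(5) by simp
    then have "y < x"
      using h(2) y(1) less.prems by (metis strict_mono_on_less)
    with h(4) y have "h y = h x"
      by simp
    then show False
      using h(1) y(1) less.prems \<open>y < x\<close> by (metis strict_mono_on_less less_irrefl)
  qed
  from this[of f g] this[of g f] f g im less.IH show ?case
    by (metis linorder_neqE)
qed

lemma col_increasing_unique: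
  assumes "S \<in> tableaux D" "T \<in> tableaux D" "col_increasing D S" "col_increasing D T"
    and im: "\<And>j. S ` {c \<in> D. snd c = j} = T ` {c \<in> D. snd c = j}"
  shows "S = T"
proof
  fix c :: "nat \<times> nat"
  obtain i j where c: "c = (i, j)"
    by (cases c)
  let ?R = "{i. (i, j) \<in> D}"
  have *: "(\<lambda>i. U (i, j)) ` ?R = U ` {c \<in> D. snd c = j}" for U :: "nat \<times> nat \<Rightarrow> nat"
    by (auto simp: image_iff)
  show "S c = T c"
  proof (cases "c \<in> D")
    case True
    have "(\<lambda>i. S (i, j)) i = (\<lambda>i. T (i, j)) i"
      by (rule strict_mono_on_image_unique[of ?R])
        (use assms True c * in \<open>auto simp: strict_mono_on_def col_increasing_def\<close>)
    then show ?thesis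
      by (simp add: c)
  qed (use assms(1,2) c in \<open>simp add: tableaux_def\<close>)
qed

lemma row_increasing_unique:
  assumes "S \<in> tableaux D" "T \<in> tableaux D" "row_increasing D S" "row_increasing D T"
    and im: "\<And>i. S ` {c \<in> D. fst c = i} = T ` {c \<in> D. fst c = i}"
  shows "S = T"
proof
  fix c :: "nat \<times> nat"
  obtain i j where c: "c = (i, j)"
    by (cases c)
  let ?R = "{j. (i, j) \<in> D}"
  have *: "(\<lambda>j. U (i, j)) ` ?R = U ` {c \<in> D. fst c = i}" for U :: "nat \<times> nat \<Rightarrow> nat"
    by (auto simp: image_iff)
  show "S c = T c"
  proof (cases "c \<in> D")
    case True
    have "(\<lambda>j. S (i, j)) j = (\<lambda>j. T (i, j)) j"
      by (rule strict_mono_on_image_unique[of ?R])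
        (use assms True c * in \<open>auto simp: strict_mono_on_def row_increasing_def\<close>)
    then show ?thesis
      by (simp add: c)
  qed (use assms(1,2) c in \<open>simp add: tableaux_def\<close>)
qed

text \<open>The right-hand side depends only on the entry sets of the fibres of \<open>f\<close>.
  With \<open>fst\<close> this makes the row weight an invariant of the tabloid, with
  \<open>snd\<close> the column weight an invariant under the column stabilizer.\<close>

lemma weighted_sum_by_image:
  fixes f :: "'a \<Rightarrow> nat" and T :: "'a \<Rightarrow> nat"
  assumes "finite D" "inj_on T D"
  shows "(\<Sum>c\<in>D. f c * T c) = (\<Sum>i\<in>f ` D. i * \<Sum> (T ` {c \<in> D. f c = i}))"
proof -
  have "(\<Sum>c\<in>D. f c * T c) = (\<Sum>i\<in>f ` D. \<Sum>c | c \<in> D \<and> f c = i. f c * T c)"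
    using assms(1) by (intro sum.group[symmetric]) auto
  also have "\<dots> = (\<Sum>i\<in>f ` D. i * \<Sum> (T ` {c \<in> D. f c = i}))"
  proof (intro sum.cong refl)
    fix i
    have "inj_on T {c \<in> D. f c = i}"
      using assms(2) by (rule inj_on_subset) auto
    then show "(\<Sum>c | c \<in> D \<and> f c = i. f c * T c) = i * \<Sum> (T ` {c \<in> D. f c = i})"
      by (simp add: sum.reindex sum_distrib_left)
  qed
  finally show ?thesis .
qed

lemma row_weight_tabloid:
  assumes "finite D" "S \<in> tableaux D" "T \<in> tableaux D" "tabloid D S = tabloid D T"
  shows "row_weight D S = row_weight D T"
  unfolding row_weight_def
  using assms tabloid_eq_iff by (simp add: weighted_sum_by_image tableaux_inj_on)

lemma column_image_comp:
  "p \<in> column_stabilizer D T \<Longrightarrow> (p \<circ> T) ` {c \<in> D. snd c = j} = T ` {c \<in> D. snd c = j}"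
  using column_stabilizerD(2)[of p D T j] by (simp only: image_comp)

text \<open>A transposition of the column stabilizer undoes an inversion in a column: the larger
  entry moves to the lower row and all other cells keep their entries.\<close>

lemma row_weight_increase:
  assumes D: "finite D" and T: "T \<in> tableaux D" and p: "p \<in> column_stabilizer D T"
    and not: "\<not> col_increasing D (p \<circ> T)"
  shows "\<exists>q\<in>column_stabilizer D T. row_weight D (p \<circ> T) < row_weight D (q \<circ> T)"
proof -
  define S where "S = p \<circ> T"
  have S: "S \<in> tableaux D"
    unfolding S_def using tableaux_comp[OF T] column_stabilizerD(1)[OF p] .
  obtain i i' j where c: "(i, j) \<in> D" "(i', j) \<in> D" "i < i'" "S (i', j) \<le> S (i, j)"
    using not unfolding col_increasing_def S_def by force
  define t where "t = transpose (S (i, j)) (S (i', j))"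
  have "S (i', j) \<noteq> S (i, j)"
    using tableaux_eq_iff[OF S c(2,1)] c(3) by simp
  with c have lt: "S (i', j) < S (i, j)"
    by simp
  have "t permutes {1..card D}"
    unfolding t_def using tableaux_image[OF S] c by (intro permutes_swap_id) auto
  moreover have "t ` T ` {c \<in> D. snd c = k} = T ` {c \<in> D. snd c = k}" for k
  proof -
    have "S e \<in> S ` {c \<in> D. snd c = k} \<longleftrightarrow> snd e = k" if "e \<in> D" for e
      using tableaux_eq_iff[OF S that] that by auto
    then show ?thesis
      unfolding t_def column_image_comp[OF p, folded S_def, symmetric] using c
      by (intro transpose_image_eq) auto
  qed
  ultimately have "t \<circ> p \<in> column_stabilizer D T"
    by (intro column_stabilizer_comp p) (simp add: column_stabilizer_def)
  moreover have "row_weight D S < row_weight D (t \<circ> S)"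
  proof -
    let ?E = "D - {(i, j), (i', j)}"
    have split: "row_weight D U = i * U (i, j) + i' * U (i', j) + (\<Sum>c\<in>?E. fst c * U c)"
      for U :: "nat \<times> nat \<Rightarrow> nat"
    proof -
      have "row_weight D U = (\<Sum>c\<in>{(i, j), (i', j)}. fst c * U c) + (\<Sum>c\<in>?E. fst c * U c)"
        unfolding row_weight_def using c D by (subst sum.subset_diff[of "{(i, j), (i', j)}"]) auto
      then show ?thesis
        using c by simp
    qed
    have "(t \<circ> S) c = S c" if "c \<in> ?E" for c
      using that tableaux_eq_iff[OF S] c(1,2) by (simp add: t_def transpose_def)
    then have "(\<Sum>c\<in>?E. fst c * (t \<circ> S) c) = (\<Sum>c\<in>?E. fst c * S c)"
      by (intro sum.cong) auto
    \<comment> \<open>The two sides differ by the row difference times the entry difference; writing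
      both as successors avoids truncated subtraction.\<close>
    moreover have "i * S (i, j) + i' * S (i', j) < i * S (i', j) + i' * S (i, j)"
    proof -
      obtain d e where "i' = i + Suc d" "S (i, j) = S (i', j) + Suc e"
        using c(3) lt by (metis less_iff_Suc_add add_Suc_right)
      then show ?thesis
        by (simp add: algebra_simps)
    qed
    ultimately show ?thesis
      unfolding split[of S] split[of "t \<circ> S"] by (simp add: t_def)
  qed
  ultimately show ?thesis
    unfolding S_def o_assoc by blast
qed

text \<open>Choose \<open>p\<close> to maximise \<open>row_weight\<close> over the finite column
  stabilizer; a remaining inversion could be swapped for a larger weight. Maximality is recorded as
  well because \<open>row_weight_std_less\<close> builds on it.\<close>

lemma column_sort:
  assumes "finite D" "T \<in> tableaux D"
  obtains p where "p \<in> column_stabilizer D T" "col_increasing D (p \<circ> T)"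
    "\<And>q. q \<in> column_stabilizer D T \<Longrightarrow> row_weight D (q \<circ> T) \<le> row_weight D (p \<circ> T)"
proof -
  let ?W = "(\<lambda>p. row_weight D (p \<circ> T)) ` column_stabilizer D T"
  have fin: "finite ?W"
    using finite_column_stabilizer by blast
  moreover have "?W \<noteq> {}"
    using id_column_stabilizer by blast
  ultimately obtain p where p: "p \<in> column_stabilizer D T" "row_weight D (p \<circ> T) = Max ?W"
    using Max_in by (metis (no_types, lifting) imageE)
  have max: "row_weight D (q \<circ> T) \<le> row_weight D (p \<circ> T)" if "q \<in> column_stabilizer D T" for q
    unfolding p(2) using fin that by (intro Max_ge) auto
  then have "col_increasing D (p \<circ> T)"
    using row_weight_increase[OF assms p(1)] by (meson leD)
  with p max that show ?thesis
    by blast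
qed

text \<open>The maximiser is column increasing with the same column sets as \<open>T\<close>, so it
  is \<open>T\<close> itself. Any other \<open>q \<circ> T\<close> then has an inversion, and its
  weight can still be raised without passing that of \<open>T\<close>.\<close>

lemma row_weight_std_less:
  assumes D: "finite D" and T: "T \<in> tableaux D" "col_increasing D T"
    and q: "q \<in> column_stabilizer D T" "q \<noteq> id"
  shows "row_weight D (q \<circ> T) < row_weight D T"
proof -
  have unique: "p \<circ> T = T" if "p \<in> column_stabilizer D T" "col_increasing D (p \<circ> T)" for p
    using that T tableaux_comp[OF T(1) column_stabilizerD(1)[OF that(1)]]
      column_image_comp[OF that(1)] by (intro col_increasing_unique) auto
  obtain p where p: "p \<in> column_stabilizer D T" "col_increasing D (p \<circ> T)"
    and max: "\<And>q. q \<in> column_stabilizer D T \<Longrightarrow> row_weight D (q \<circ> T) \<le> row_weight D (p \<circ> T)"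
    using column_sort[OF D T(1)] by blast
  have max: "row_weight D (q \<circ> T) \<le> row_weight D T" if "q \<in> column_stabilizer D T" for q
    using max[OF that] unique[OF p] by simp
  have "q \<circ> T \<noteq> T"
  proof
    assume "q \<circ> T = T"
    then have "q x = x" if "x \<in> {1..card D}" for x
      using that tableaux_image[OF T(1)] by (metis comp_apply imageE)
    moreover have "q x = x" if "x \<notin> {1..card D}" for x
      using that column_stabilizerD(1)[OF q(1)] by (simp add: permutes_not_in)
    ultimately show False
      using q(2) by (auto simp: fun_eq_iff)
  qed
  then have "\<not> col_increasing D (q \<circ> T)"
    using unique[OF q(1)] by blast
  with row_weight_increase[OF D T(1) q(1)] max show ?thesis
    by (meson le_trans not_le)
qed

section \<open>Triangularity of the standard polytabloids\<close>

lemma std_tableauxD: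
  "T \<in> std_tableaux D \<Longrightarrow> T \<in> tableaux D"
  "T \<in> std_tableaux D \<Longrightarrow> row_increasing D T"
  "T \<in> std_tableaux D \<Longrightarrow> col_increasing D T"
  by (auto simp: std_tableaux_def)

text \<open>Only the identity contributes, since every other term has a tabloid of smaller
  weight.\<close>

lemma polytabloid_leading:
  assumes D: "finite D" and T: "T \<in> std_tableaux D"
  shows "polytabloid D T (tabloid D T) = 1"
proof -
  have "tabloid D T = tabloid D (p \<circ> T) \<longleftrightarrow> p = id" if "p \<in> column_stabilizer D T" for p
    using row_weight_std_less[OF D std_tableauxD(1,3)[OF T] that]
      row_weight_tabloid[OF D std_tableauxD(1)[OF T] tableaux_comp[OF std_tableauxD(1)[OF T]
        column_stabilizerD(1)[OF that]]] by (metis id_comp less_irrefl)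
  then have "polytabloid D T (tabloid D T) = (\<Sum>p\<in>column_stabilizer D T. if p = id then 1 else 0)"
    unfolding polytabloid_def by (intro sum.cong) auto
  then show ?thesis
    using finite_column_stabilizer id_column_stabilizer by simp
qed

text \<open>The tabloid of \<open>T\<close> must come from some \<open>p \<circ> S\<close>, which
  weighs less than \<open>S\<close> unless \<open>p = id\<close>. The identity is excluded because
  increasing rows recover a tableau from its tabloid.\<close>

lemma polytabloid_triangular:
  assumes D: "finite D" and T: "T \<in> std_tableaux D" and S: "S \<in> std_tableaux D"
    and nz: "polytabloid D S (tabloid D T) \<noteq> 0" and "S \<noteq> T"
  shows "row_weight D T < row_weight D S"
proof -
  obtain p where p: "p \<in> column_stabilizer D S" "tabloid D T = tabloid D (p \<circ> S)"
    using sum.not_neutral_contains_not_neutral[OF nz[unfolded polytabloid_def]] by metis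
  have w: "row_weight D T = row_weight D (p \<circ> S)"
    using row_weight_tabloid[OF D std_tableauxD(1)[OF T] tableaux_comp[OF std_tableauxD(1)[OF S]
          column_stabilizerD(1)[OF p(1)]] p(2)] .
  have "p \<noteq> id"
  proof
    assume "p = id"
    with p have "T = S"
      using std_tableauxD[OF T] std_tableauxD[OF S] tabloid_eq_iff[of T D S]
      by (intro row_increasing_unique) (simp_all, blast)
    with \<open>S \<noteq> T\<close> show False by simp
  qed
  with w row_weight_std_less[OF D std_tableauxD(1,3)[OF S] p(1)] show ?thesis
    by simp
qed

text \<open>Among the tableaux with nonzero coefficient take one of greatest weight and evaluate at
  its tabloid: all other terms vanish. The family form is needed first, since injectivity of
  \<open>polytabloid\<close> on standard tableaux is deduced from it.\<close>

lemma std_polytabloids_independent_family: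
  assumes D: "finite D" and zero: "\<And>X. (\<Sum>T\<in>std_tableaux D. a T * polytabloid D T X) = 0"
    and T: "T \<in> std_tableaux D"
  shows "a T = 0"
proof (rule ccontr)
  assume "a T \<noteq> 0"
  let ?M = "{T \<in> std_tableaux D. a T \<noteq> 0}"
  have fin: "finite ?M"
    using finite_std_tableaux[OF D] by simp
  then have "Max (row_weight D ` ?M) \<in> row_weight D ` ?M"
    using T \<open>a T \<noteq> 0\<close> by (intro Max_in) auto
  then obtain S where S: "S \<in> ?M" "row_weight D S = Max (row_weight D ` ?M)"
    by (metis (no_types, lifting) imageE)
  have "a U * polytabloid D U (tabloid D S) = 0" if "U \<in> std_tableaux D - {S}" for U
  proof (rule ccontr)
    assume *: "a U * polytabloid D U (tabloid D S) \<noteq> 0"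
    then have "row_weight D S < row_weight D U"
      using that S by (intro polytabloid_triangular[OF D]) auto
    moreover have "row_weight D U \<le> row_weight D S"
      unfolding S(2) using fin that * by (intro Max_ge) auto
    ultimately show False by simp
  qed
  then have "(\<Sum>U\<in>std_tableaux D - {S}. a U * polytabloid D U (tabloid D S)) = 0"
    by (rule sum.neutral[OF ballI])
  then have "(\<Sum>U\<in>std_tableaux D. a U * polytabloid D U (tabloid D S)) = a S"
    using S finite_std_tableaux[OF D] polytabloid_leading[OF D]
    by (subst sum.remove[of _ S]) auto
  with zero S show False
    by simp
qed

lemma inj_on_polytabloid:
  assumes "finite D"
  shows "inj_on (polytabloid D) (std_tableaux D)"
proof (rule inj_onI, rule ccontr)
  fix S T assume *: "S \<in> std_tableaux D" "T \<in> std_tableaux D" "polytabloid D S = polytabloid D T" "S \<noteq> T"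
  \<comment> \<open>A coincidence would be a linear relation with coefficients 1 and -1.\<close>
  let ?a = "\<lambda>U. (if U = S then 1 else 0) - (if U = T then 1 else (0::complex))"
  have "(\<Sum>U\<in>std_tableaux D. ?a U * polytabloid D U X) = 0" for X
    using * finite_std_tableaux[OF assms]
    by (simp add: left_diff_distrib sum_subtractf if_distrib[of "\<lambda>x. x * _"] cong: if_cong)
  from std_polytabloids_independent_family[OF assms this *(1)] *(4) show False
    by simp
qed

lemma sum_fun_apply: "(\<Sum>i\<in>I. f i) x = (\<Sum>i\<in>I. f i x)"
  for f :: "'i \<Rightarrow> 'a \<Rightarrow> 'b::comm_monoid_add"
  by (induction I rule: infinite_finite_induct) auto

lemma independent_std_polytabloids:
  assumes "finite D"
  shows "cfun.independent (polytabloid D ` std_tableaux D)"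
proof -
  have fin: "finite (polytabloid D ` std_tableaux D)"
    using finite_std_tableaux[OF assms] by simp
  have zero: "u v = 0" if v: "v \<in> polytabloid D ` std_tableaux D"
    and sum: "(\<Sum>v\<in>polytabloid D ` std_tableaux D. (\<lambda>x. u v * v x)) = 0" for u v
  proof -
    have "(\<Sum>T\<in>std_tableaux D. u (polytabloid D T) * polytabloid D T X) = 0" for X
      using fun_cong[OF sum, of X]
      by (simp add: sum_fun_apply sum.reindex[OF inj_on_polytabloid[OF assms]])
    from std_polytabloids_independent_family[OF assms this] v show ?thesis
      by auto
  qed
  show ?thesis
    unfolding cfun.dependent_finite[OF fin]
  proof (intro notI, elim exE conjE bexE)
    fix u v assume "v \<in> polytabloid D ` std_tableaux D" "u v \<noteq> 0"
      "(\<Sum>v\<in>polytabloid D ` std_tableaux D. (\<lambda>x. u v * v x)) = 0"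
    with zero[of v u] show False
      by blast
  qed
qed


section \<open>Straightening\<close>

definition down_closed :: "(nat \<times> nat) set \<Rightarrow> bool" where
  "down_closed D \<longleftrightarrow> (\<forall>i j i' j'. (i, j) \<in> D \<longrightarrow> i' \<le> i \<longrightarrow> j' \<le> j \<longrightarrow> (i', j') \<in> D)"

text \<open>The measure that drives straightening: unchanged by sorting columns, and larger once
  large entries move to the right.\<close>

definition col_weight :: "(nat \<times> nat) set \<Rightarrow> (nat \<times> nat \<Rightarrow> nat) \<Rightarrow> nat" where
  "col_weight D T = (\<Sum>c\<in>D. snd c * T c)"

lemma down_closedD: "down_closed D \<Longrightarrow> (i, j) \<in> D \<Longrightarrow> i' \<le> i \<Longrightarrow> j' \<le> j \<Longrightarrow> (i', j') \<in> D"
  unfolding down_closed_def by blast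

lemma col_weight_column_stabilizer:
  assumes "finite D" "T \<in> tableaux D" "p \<in> column_stabilizer D T"
  shows "col_weight D (p \<circ> T) = col_weight D T"
  unfolding col_weight_def
  using assms column_image_comp[OF assms(3)]
    tableaux_inj_on[OF tableaux_comp[OF assms(2) column_stabilizerD(1)[OF assms(3)]]]
  by (simp only: weighted_sum_by_image tableaux_inj_on)

text \<open>As many elements leave \<open>B\<close> as enter from \<open>A\<close>. If
  \<open>m\<close> is the greatest one that leaves, each that enters is at least
  \<open>Suc m\<close>.\<close>

lemma sum_image_less:
  fixes A B :: "nat set"
  assumes fin: "finite A" "finite B" and less: "\<And>a b. a \<in> A \<Longrightarrow> b \<in> B \<Longrightarrow> b < a"
    and s: "inj_on s B" "s ` B \<subseteq> A \<union> B" "s ` B \<noteq> B"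
  shows "\<Sum>B < (\<Sum>b\<in>B. s b)"
proof -
  let ?M = "s ` B"
  have finM: "finite ?M" and cardM: "card ?M = card B"
    using fin s(1) by (auto simp: card_image)
  have card: "card (B - ?M) = card (?M - B)"
    using card_Diff_subset_Int[of B ?M] card_Diff_subset_Int[of ?M B] fin finM cardM
    by (simp add: Int_commute)
  have "B - ?M \<noteq> {}"
    using s(3) card_subset_eq[OF finM, of B] cardM by auto
  then have ne: "card (B - ?M) > 0"
    using fin by (simp add: card_gt_0_iff)
  define m where "m = Max (B - ?M)"
  have m: "m \<in> B"
    using Max_in[of "B - ?M"] fin \<open>B - ?M \<noteq> {}\<close> by (auto simp: m_def)
  have "\<Sum> (B - ?M) \<le> card (B - ?M) * m"
    using fin by (intro order_trans[OF sum_bounded_above[where K = m]]) (auto simp: m_def)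
  also have "\<dots> < card (?M - B) * Suc m"
    using card ne by simp
  also have "\<dots> \<le> \<Sum> (?M - B)"
    using less[OF _ m] s(2)
    by (intro order_trans[OF _ sum_bounded_below[where K = "Suc m"]]) (auto simp: Suc_le_eq)
  finally have "\<Sum> (B - ?M) + \<Sum> (B \<inter> ?M) < \<Sum> (?M - B) + \<Sum> (B \<inter> ?M)"
    by simp
  moreover have "\<Sum> (B - ?M) + \<Sum> (B \<inter> ?M) = \<Sum> B"
    using sum.Int_Diff[OF fin(2), of "\<lambda>x. x" ?M] by simp
  moreover have "\<Sum> (?M - B) + \<Sum> (B \<inter> ?M) = \<Sum> ?M"
    using sum.Int_Diff[OF finM, of "\<lambda>x. x" B] by (simp add: Int_commute)
  moreover have "\<Sum> ?M = (\<Sum>b\<in>B. s b)"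
    using sum.reindex[OF s(1), of "\<lambda>x. x"] by simp
  ultimately show ?thesis
    by simp
qed

text \<open>
  For a row descent of \<open>T\<close> at \<open>(i, j), (i, j')\<close>, the Garnir relation is applied to the entries
  weakly below \<open>(i, j)\<close> and weakly above \<open>(i, j')\<close>. All the former exceed all the latter, so every
  permutation mixing the two groups moves large entries to the right.
\<close>

locale row_descent =
  fixes D :: "(nat \<times> nat) set" and T :: "nat \<times> nat \<Rightarrow> nat" and i j j' :: nat
  assumes fin: "finite D" and down: "down_closed D"
    and T: "T \<in> tableaux D" and col: "col_increasing D T"
    and cells: "(i, j) \<in> D" "(i, j') \<in> D" and jj': "j < j'" and descent: "T (i, j') < T (i, j)"
begin

definition DA where "DA = {c \<in> D. snd c = j \<and> i \<le> fst c}"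
definition DB where "DB = {c \<in> D. snd c = j' \<and> fst c \<le> i}"
definition A where "A = T ` DA"
definition B where "B = T ` DB"

lemma finite_sets: "finite DA" "finite DB" "finite A" "finite B"
  using fin by (auto simp: DA_def DB_def A_def B_def)

lemma B_less_A:
  assumes "a \<in> A" "b \<in> B"
  shows "b < a"
proof -
  obtain k l where k: "(k, j) \<in> D" "i \<le> k" "a = T (k, j)" and l: "(l, j') \<in> D" "l \<le> i" "b = T (l, j')"
    using assms by (auto simp: A_def B_def DA_def DB_def)
  have "T (i, j) \<le> T (k, j)"
    using col k cells unfolding col_increasing_def by (cases "i = k") (auto simp: less_imp_le)
  moreover have "T (l, j') \<le> T (i, j')"
    using col l cells unfolding col_increasing_def by (cases "i = l") (auto simp: less_imp_le)
  ultimately show ?thesis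
    using descent k l by simp
qed

lemma disjoint: "A \<inter> B = {}"
  using B_less_A by blast

lemma U_subset: "A \<union> B \<subseteq> {1..card D}"
  unfolding tableaux_image[OF T, symmetric] by (auto simp: A_def B_def DA_def DB_def)

text \<open>Pigeonhole: in \<open>p \<circ> T\<close> the entries of \<open>A\<close> still lie in
  column \<open>j\<close> and those of \<open>B\<close> in column \<open>j'\<close>. Every row that
  meets column \<open>j'\<close> also meets column \<open>j\<close>, and column \<open>j\<close> has
  at most \<open>card A + i\<close> cells, while \<open>card B\<close> is
  \<open>i + 1\<close>.\<close>

lemma common_row:
  assumes p: "p \<in> column_stabilizer D T"
  shows "\<exists>c\<in>D. \<exists>c'\<in>D. c \<noteq> c' \<and> fst c = fst c' \<and> p (T c) \<in> A \<union> B \<and> p (T c') \<in> A \<union> B"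
proof -
  let ?S = "p \<circ> T"
  have S: "?S \<in> tableaux D"
    using tableaux_comp[OF T] column_stabilizerD(1)[OF p] .
  define rows where "rows = (\<lambda>X l. {k. (k, l) \<in> D \<and> ?S (k, l) \<in> X})"
  have card_rows: "card (rows X l) = card X" if "X \<subseteq> T ` {c \<in> D. snd c = l}" for X l
  proof -
    have "inj_on (\<lambda>k. ?S (k, l)) (rows X l)"
      using tableaux_inj_on[OF S] by (auto simp: inj_on_def rows_def)
    moreover have "(\<lambda>k. ?S (k, l)) ` rows X l = X"
      using that unfolding column_image_comp[OF p, symmetric] by (auto simp: rows_def)
    ultimately show ?thesis
      using card_image by metis
  qed
  define R where "R = {k. (k, j) \<in> D}"
  have finR: "finite R"
    using finite_imageI[OF fin, of fst] by (rule rev_finite_subset) (force simp: R_def)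
  have cardA: "card A = card {k \<in> R. i \<le> k}"
  proof -
    have "DA = (\<lambda>k. (k, j)) ` {k \<in> R. i \<le> k}"
      by (auto simp: DA_def R_def)
    moreover have "inj_on T DA"
      using tableaux_inj_on[OF T] by (rule inj_on_subset) (auto simp: DA_def)
    ultimately show ?thesis
      by (simp add: A_def card_image inj_on_def)
  qed
  have cardB: "card B = Suc i"
  proof -
    have "DB = (\<lambda>k. (k, j')) ` {..i}"
      using down_closedD[OF down cells(2)] by (auto simp: DB_def)
    moreover have "inj_on T DB"
      using tableaux_inj_on[OF T] by (rule inj_on_subset) (auto simp: DB_def)
    ultimately show ?thesis
      by (simp add: B_def card_image inj_on_def)
  qed
  have "card R \<le> card ({k \<in> R. i \<le> k} \<union> {..<i})"
    using finR by (intro card_mono) auto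
  also have "\<dots> \<le> card {k \<in> R. i \<le> k} + card {..<i}"
    by (rule card_Un_le)
  finally have "card R < card A + card B"
    using cardA cardB by simp
  moreover have "card A = card (rows A j)" "card B = card (rows B j')"
    by (subst card_rows; auto simp: A_def B_def DA_def DB_def)+
  moreover have sub: "rows A j \<union> rows B j' \<subseteq> R"
    using down_closedD[OF down] jj' by (auto simp: rows_def R_def)
  moreover from this finR have "finite (rows A j)" "finite (rows B j')"
    using finite_subset by blast+
  ultimately have "rows A j \<inter> rows B j' \<noteq> {}"
    using card_mono[OF finR sub] card_Un_disjoint[of "rows A j" "rows B j'"] by auto
  then obtain k where "(k, j) \<in> D" "?S (k, j) \<in> A" "(k, j') \<in> D" "?S (k, j') \<in> B"
    by (auto simp: rows_def)
  then show ?thesis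
    using jj' by (intro bexI[of _ "(k, j)"] bexI[of _ "(k, j')"]) auto
qed

text \<open>Such an \<open>s\<close> preserves \<open>A\<close> too, and each column of
  \<open>T\<close> meets \<open>A \<union> B\<close> in nothing, in \<open>A\<close> or in
  \<open>B\<close>. In the Garnir relation these permutations contribute copies of the polytabloid
  of \<open>T\<close> itself.\<close>

lemma column_stabilizer_if_preserves:
  assumes s: "s permutes A \<union> B" "s ` B = B"
  shows "s \<in> column_stabilizer D T"
proof -
  have inj: "inj s"
    using s(1) permutes_inj by blast
  have "s ` A = s ` ((A \<union> B) - B)"
    using disjoint by (metis Diff_triv Un_Diff_cancel2 Un_Diff Diff_cancel Un_empty_right)
  also have "\<dots> = A"
    using permutes_image[OF s(1)] s(2) disjoint by (auto simp: image_set_diff[OF inj])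
  finally have sA: "s ` A = A" .
  have "s ` X = X" if "X \<inter> (A \<union> B) \<in> {{}, A, B}" for X
  proof -
    have "s ` (X \<inter> (A \<union> B)) = X \<inter> (A \<union> B)"
      using that sA s(2) by auto
    moreover have "s ` (X - (A \<union> B)) = X - (A \<union> B)"
      using permutes_not_in[OF s(1)] by (auto simp: image_iff)
    ultimately show ?thesis
      by (metis Int_Diff_Un image_Un)
  qed
  moreover have "T ` {c \<in> D. snd c = k} \<inter> (A \<union> B) \<in> {{}, A, B}" for k
  proof -
    have "T ` {c \<in> D. snd c = k} \<inter> (A \<union> B) = T ` ({c \<in> D. snd c = k} \<inter> (DA \<union> DB))"
      using tableaux_inj_on[OF T] unfolding A_def B_def image_Un[symmetric]
      by (intro inj_on_image_Int[symmetric, of T D]) (auto simp: DA_def DB_def)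
    moreover have "{c \<in> D. snd c = k} \<inter> (DA \<union> DB) = (if k = j then DA else if k = j' then DB else {})"
      using jj' by (auto simp: DA_def DB_def)
    ultimately show ?thesis
      by (simp add: A_def B_def)
  qed
  moreover have "s permutes {1..card D}"
    using s(1) U_subset permutes_subset by blast
  ultimately show ?thesis
    by (simp add: column_stabilizer_def)
qed

text \<open>The changes of the entries on \<open>A\<close> and on \<open>B\<close> cancel in total,
  so the weight changes by \<open>j' - j\<close> times the change on \<open>B\<close>, which is
  positive by \<open>sum_image_less\<close>.\<close>

lemma col_weight_mixed:
  assumes s: "s permutes A \<union> B" "s ` B \<noteq> B"
  shows "col_weight D T < col_weight D (s \<circ> T)"
proof -
  define g where "g = (\<lambda>u. int (s u) - int u)"
  have sumU: "sum g A + sum g B = 0"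
  proof -
    have "sum g A + sum g B = sum g (A \<union> B)"
      using finite_sets disjoint by (simp add: sum.union_disjoint)
    also have "\<dots> = (\<Sum>u\<in>A \<union> B. int (s u)) - (\<Sum>u\<in>A \<union> B. int u)"
      by (simp add: g_def sum_subtractf)
    also have "(\<Sum>u\<in>A \<union> B. int (s u)) = (\<Sum>u\<in>A \<union> B. int u)"
      by (rule sum.permute[OF s(1), of int, unfolded o_def, symmetric])
    finally show ?thesis by simp
  qed
  have "inj_on T DA" "inj_on T DB"
    using tableaux_inj_on[OF T] by (rule inj_on_subset; auto simp: DA_def DB_def)+
  then have red: "(\<Sum>c\<in>DA. g (T c)) = sum g A" "(\<Sum>c\<in>DB. g (T c)) = sum g B"
    by (simp_all add: A_def B_def sum.reindex)
  have "int (col_weight D (s \<circ> T)) - int (col_weight D T) = (\<Sum>c\<in>D. int (snd c) * g (T c))"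
    by (simp add: col_weight_def g_def sum_subtractf right_diff_distrib)
  also have "\<dots> = (\<Sum>c\<in>DA \<union> DB. int (snd c) * g (T c))"
  proof (rule sum.mono_neutral_right[OF fin])
    show "\<forall>c\<in>D - (DA \<union> DB). int (snd c) * g (T c) = 0"
    proof
      fix c assume c: "c \<in> D - (DA \<union> DB)"
      then have "T c \<notin> A \<union> B"
        using tableaux_eq_iff[OF T, of c] by (auto simp: A_def B_def DA_def DB_def)
      then show "int (snd c) * g (T c) = 0"
        using permutes_not_in[OF s(1)] by (simp add: g_def)
    qed
  qed (auto simp: DA_def DB_def)
  also have "\<dots> = (\<Sum>c\<in>DA. int (snd c) * g (T c)) + (\<Sum>c\<in>DB. int (snd c) * g (T c))"
    using finite_sets jj' by (intro sum.union_disjoint) (auto simp: DA_def DB_def)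
  also have "\<dots> = (\<Sum>c\<in>DA. int j * g (T c)) + (\<Sum>c\<in>DB. int j' * g (T c))"
    by (intro arg_cong2[of _ _ _ _ "(+)"] sum.cong) (auto simp: DA_def DB_def)
  also have "\<dots> = int j * sum g A + int j' * sum g B"
    by (simp add: red flip: sum_distrib_left)
  also have "\<dots> = (int j' - int j) * sum g B"
    using sumU by (simp add: eq_neg_iff_add_eq_0[symmetric] left_diff_distrib)
  also have "\<dots> > 0"
  proof -
    have "\<Sum>B < (\<Sum>b\<in>B. s b)"
      using finite_sets B_less_A s permutes_inj[OF s(1)] permutes_image[OF s(1)]
      by (intro sum_image_less[of A]) (auto intro: inj_on_subset)
    then have "int (\<Sum>B) < int (\<Sum>b\<in>B. s b)"
      by (simp only: of_nat_less_iff)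
    then have "sum g B > 0"
      by (simp add: g_def sum_subtractf)
    with jj' show ?thesis
      by simp
  qed
  finally show ?thesis
    by simp
qed

text \<open>Each permutation in \<open>H\<close> contributes exactly the polytabloid of
  \<open>T\<close>, its sign occurring twice. Summing over the whole symmetric group of
  \<open>A \<union> B\<close> instead of coset representatives therefore costs only the factor
  \<open>card H\<close>, which is invertible over the complex numbers.\<close>

lemma polytabloid_in_span:
  assumes IH: "\<And>S. S \<in> tableaux D \<Longrightarrow> col_weight D T < col_weight D S \<Longrightarrow> polytabloid D S \<in> cfun.span V"
  shows "polytabloid D T \<in> cfun.span V"
proof -
  let ?P = "{s. s permutes A \<union> B}"
  let ?f = "\<lambda>s x. of_int (sign s) * polytabloid D (s \<circ> T) x"
  define H where "H = {s \<in> ?P. s ` B = B}"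
  have finP: "finite ?P"
    using finite_sets by (intro finite_permutations) simp
  have HP: "H \<subseteq> ?P" "finite H"
    using finP by (auto simp: H_def intro: finite_subset)
  have "id \<in> H"
    by (simp add: H_def permutes_id)
  then have cardH: "of_nat (card H) \<noteq> (0::complex)"
    using HP(2) by auto
  have onH: "?f s x = polytabloid D T x" if "s \<in> H" for s x
  proof -
    have "s \<in> column_stabilizer D T"
      using that column_stabilizer_if_preserves by (simp add: H_def)
    then show ?thesis
      by (simp add: polytabloid_column_stabilizer sign_def)
  qed
  have eq: "of_nat (card H) * polytabloid D T x + (\<Sum>s\<in>?P - H. ?f s x) = 0" for x
  proof -
    have "(\<Sum>s\<in>?P. ?f s x) = 0"
      by (rule garnir_relation[OF T U_subset common_row])
    moreover have "(\<Sum>s\<in>?P. ?f s x) = (\<Sum>s\<in>?P - H. ?f s x) + (\<Sum>s\<in>H. ?f s x)"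
      by (rule sum.subset_diff[OF HP(1) finP])
    moreover have "(\<Sum>s\<in>H. ?f s x) = of_nat (card H) * polytabloid D T x"
      by (simp only: onH cong: sum.cong) simp
    ultimately show ?thesis
      by (simp add: add.commute)
  qed
  have "?f s \<in> cfun.span V" if "s \<in> ?P - H" for s
  proof (rule cfun.span_scale, rule IH)
    show "s \<circ> T \<in> tableaux D"
      using that U_subset permutes_subset by (intro tableaux_comp[OF T]) blast
    show "col_weight D T < col_weight D (s \<circ> T)"
      using that by (intro col_weight_mixed) (auto simp: H_def)
  qed
  then have "(\<Sum>s\<in>?P - H. ?f s) \<in> cfun.span V"
    by (rule cfun.span_sum)
  then have "(\<lambda>x. (- 1 / of_nat (card H)) * (\<Sum>s\<in>?P - H. ?f s) x) \<in> cfun.span V"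
    by (rule cfun.span_scale)
  moreover have "(\<lambda>x. (- 1 / of_nat (card H)) * (\<Sum>s\<in>?P - H. ?f s) x) = polytabloid D T"
  proof
    fix x
    have "(\<Sum>s\<in>?P - H. ?f s x) = - (of_nat (card H) * polytabloid D T x)"
      using eq[of x] by (simp add: eq_neg_iff_add_eq_0 add.commute)
    then show "(- 1 / of_nat (card H)) * (\<Sum>s\<in>?P - H. ?f s) x = polytabloid D T x"
      using cardH by (simp add: sum_fun_apply)
  qed
  ultimately show ?thesis
    by metis
qed

end

text \<open>Sorting the columns changes only the sign and keeps \<open>col_weight\<close>; a
  remaining row descent is then traded for tableaux of greater weight, which cannot go on
  forever.\<close>

lemma polytabloid_in_span_std:
  assumes fin: "finite D" and down: "down_closed D" and T: "T \<in> tableaux D"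
  shows "polytabloid D T \<in> cfun.span (polytabloid D ` std_tableaux D)"
proof -
  \<comment> \<open>Entries are at most \<open>card D\<close>, so \<open>N\<close> bounds all column
    weights and \<open>N - col_weight D T\<close> can serve as the termination measure.\<close>
  define N where "N = (\<Sum>c\<in>D. snd c * card D)"
  have N: "col_weight D T \<le> N" if "T \<in> tableaux D" for T
    unfolding col_weight_def N_def using tableaux_image[OF that] by (intro sum_mono mult_le_mono) auto
  show ?thesis
    using T
  proof (induction "N - col_weight D T" arbitrary: T rule: less_induct)
    case less
    obtain p where p: "p \<in> column_stabilizer D T" "col_increasing D (p \<circ> T)"
      using column_sort[OF fin less.prems] by blast
    define S where "S = p \<circ> T"
    have S: "S \<in> tableaux D"
      unfolding S_def using tableaux_comp[OF less.prems] column_stabilizerD(1)[OF p(1)] .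
    have w: "col_weight D S = col_weight D T"
      unfolding S_def using col_weight_column_stabilizer[OF fin less.prems p(1)] .
    have "polytabloid D S \<in> cfun.span (polytabloid D ` std_tableaux D)"
    proof (cases "S \<in> std_tableaux D")
      case True
      then show ?thesis
        by (intro cfun.span_base) simp
    next
      case False
      then have "\<not> row_increasing D S"
        using p(2) S by (simp add: std_tableaux_def S_def)
      then obtain i j j' where ij: "(i, j) \<in> D" "(i, j') \<in> D" "j < j'" "\<not> S (i, j) < S (i, j')"
        unfolding row_increasing_def by blast
      moreover have "S (i, j) \<noteq> S (i, j')"
        using tableaux_eq_iff[OF S ij(1,2)] ij(3) by simp
      ultimately interpret row_descent D S i j j'
        using fin down S p(2) by unfold_locales (auto simp: S_def)
      show ?thesis
      proof (rule polytabloid_in_span)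
        fix S' assume "S' \<in> tableaux D" "col_weight D S < col_weight D S'"
        with less.hyps[of S'] N[of S'] w show "polytabloid D S' \<in> cfun.span (polytabloid D ` std_tableaux D)"
          by simp
      qed
    qed
    then have "(\<lambda>x. of_int (sign p) * polytabloid D S x) \<in> cfun.span (polytabloid D ` std_tableaux D)"
      by (rule cfun.span_scale)
    moreover have "(\<lambda>x. of_int (sign p) * polytabloid D S x) = polytabloid D T"
      unfolding S_def polytabloid_column_stabilizer[OF p(1)] by (simp add: sign_def fun_eq_iff)
    ultimately show ?case
      by metis
  qed
qed

lemma dim_L_eq_card_std_tableaux:
  assumes "finite D" "down_closed D"
  shows "dim_L D = card (std_tableaux D)"
proof -
  have "polytabloid D ` std_tableaux D \<subseteq> polytabloid D ` tableaux D"
    by (auto simp: std_tableaux_def)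
  then have "specht_module D = cfun.span (polytabloid D ` std_tableaux D)"
    unfolding specht_module_def cfun.span_eq
    using polytabloid_in_span_std[OF assms] cfun.span_superset by blast
  then show ?thesis
    unfolding dim_L_def
    by (simp add: cfun.dim_eq_card_independent independent_std_polytabloids
        card_image inj_on_polytabloid assms)
qed


section \<open>Row lengths and the branching recurrence\<close>

definition row_length :: "(nat \<times> nat) set \<Rightarrow> nat \<Rightarrow> nat" where
  "row_length D i = card {j. (i, j) \<in> D}"

lemma initial_segment_eq:
  fixes S :: "nat set"
  assumes "finite S" "\<And>x y. x \<in> S \<Longrightarrow> y \<le> x \<Longrightarrow> y \<in> S"
  shows "S = {..<card S}"
proof (cases "S = {}")
  case False
  have "S = {..Max S}"
    using assms(2)[OF Max_in[OF assms(1) False]] assms(1) by auto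
  then have "S = {..<Suc (Max S)}"
    by (simp add: lessThan_Suc_atMost)
  then show ?thesis
    by (metis card_lessThan)
qed simp

lemma mem_iff_row_length:
  assumes "finite D" "down_closed D"
  shows "(i, j) \<in> D \<longleftrightarrow> j < row_length D i"
proof -
  have "finite {j. (i, j) \<in> D}"
    using finite_imageI[OF assms(1), of snd] by (rule rev_finite_subset) force
  then have "{j. (i, j) \<in> D} = {..<row_length D i}"
    unfolding row_length_def using down_closedD[OF assms(2)] by (intro initial_segment_eq) auto
  then show ?thesis
    by blast
qed

lemma row_length_antimono:
  assumes "finite D" "down_closed D" "i \<le> i'"
  shows "row_length D i' \<le> row_length D i"
proof (rule ccontr)
  assume "\<not> ?thesis"
  then have "(i', row_length D i) \<in> D"
    using mem_iff_row_length[OF assms(1,2)] by simp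
  then have "(i, row_length D i) \<in> D"
    using down_closedD[OF assms(2)] assms(3) by blast
  then show False
    using mem_iff_row_length[OF assms(1,2)] by simp
qed

text \<open>Trades the existence of a partition for a closure property that can be checked directly
  after a cell is inserted or deleted.\<close>

lemma young_diagram_iff: "young_diagram D \<longleftrightarrow> finite D \<and> down_closed D"
proof
  assume "young_diagram D"
  then obtain lam where lam: "is_partition lam" and D: "D = cells lam"
    unfolding young_diagram_def by blast
  have "D = (SIGMA i:{..<length lam}. {..<lam ! i})"
    by (auto simp: D cells_def)
  moreover have "lam ! i' \<le> lam ! i" if "i \<le> i'" "i' < length lam" for i i'
    using that lam by (cases "i = i'") (auto simp: is_partition_def sorted_wrt_iff_nth_less)
  then have "down_closed D"
    unfolding D down_closed_def cells_def by fastforce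
  ultimately show "finite D \<and> down_closed D"
    by (metis finite_SigmaI finite_lessThan)
next
  assume D: "finite D \<and> down_closed D"
  \<comment> \<open>The length of the first column, so that \<open>lam\<close> lists exactly the
    nonempty rows.\<close>
  define r where "r = card {i. (i, 0) \<in> D}"
  have "finite {i. (i, 0) \<in> D}"
  proof (rule finite_subset)
    show "{i. (i, 0) \<in> D} \<subseteq> fst ` D"
      by force
    show "finite (fst ` D)"
      using D by blast
  qed
  then have "{i. (i, 0) \<in> D} = {..<r}"
    unfolding r_def using D down_closedD[of D] by (intro initial_segment_eq) auto
  then have "(i, 0) \<in> D \<longleftrightarrow> i < r" for i
    by blast
  then have r: "0 < row_length D i \<longleftrightarrow> i < r" for i
    using mem_iff_row_length[of D i 0] D by blast
  define lam where "lam = map (row_length D) [0..<r]"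
  have "is_partition lam"
    using r D row_length_antimono[of D] unfolding lam_def is_partition_def
    by (auto simp: sorted_wrt_iff_nth_less) (metis less_irrefl)
  moreover have "cells lam = D"
  proof (rule set_eqI, clarify)
    fix i j
    have "j < row_length D i \<Longrightarrow> i < r"
      using r[of i] by simp
    then show "(i, j) \<in> cells lam \<longleftrightarrow> (i, j) \<in> D"
      using mem_iff_row_length[of D i j] D by (auto simp: cells_def lam_def)
  qed
  ultimately show "young_diagram D"
    unfolding young_diagram_def by blast
qed

lemma card_cells: "card (cells lam) = sum_list lam"
proof -
  have "cells lam = (SIGMA i:{..<length lam}. {..<lam ! i})"
    by (auto simp: cells_def)
  then show ?thesis
    by (simp add: sum_list_sum_nth atLeast0LessThan)
qed

section \<open>Corners in terms of row lengths, and branching\<close>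

lemma addable_eq:
  assumes "finite D" "down_closed D"
  shows "addable D = (\<lambda>i. (i, row_length D i)) ` {i. i = 0 \<or> row_length D i < row_length D (i - 1)}"
    (is "_ = ?R")
proof (intro equalityI subsetI)
  note mem = mem_iff_row_length[OF assms]
  fix c assume "c \<in> addable D"
  then obtain i j where c: "c = (i, j)" "(i, j) \<notin> D" and dc: "down_closed (insert (i, j) D)"
    by (cases c) (auto simp: addable_def young_diagram_iff)
  have "j = row_length D i"
  proof (rule antisym)
    show "row_length D i \<le> j"
      using c(2) mem by (simp add: not_less)
    show "j \<le> row_length D i"
      using down_closedD[OF dc, of i j i "row_length D i"] mem[of i "row_length D i"] by fastforce
  qed
  moreover have "i = 0 \<or> row_length D i < row_length D (i - 1)"
    using down_closedD[OF dc, of i j "i - 1" j] mem calculation by auto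
  ultimately show "c \<in> ?R"
    using c by blast
next
  note mem = mem_iff_row_length[OF assms]
  fix c assume "c \<in> ?R"
  then obtain i where c: "c = (i, row_length D i)" and i: "i = 0 \<or> row_length D i < row_length D (i - 1)"
    by blast
  have "(a, b) \<in> insert c D" if "a \<le> i" "b \<le> row_length D i" for a b
  proof (cases "a = i")
    case False
    with that i have "b < row_length D (i - 1)" "a \<le> i - 1"
      by auto
    then have "b < row_length D a"
      using row_length_antimono[OF assms] by (meson less_le_trans)
    then show ?thesis
      using mem by simp
  qed (use that mem c in auto)
  then have "down_closed (insert c D)"
    using down_closedD[OF assms(2)] c unfolding down_closed_def by blast
  then show "c \<in> addable D"
    using assms mem c by (simp add: addable_def young_diagram_iff)
qed

lemma removable_eq:
  assumes "finite D" "down_closed D"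
  shows "removable D = (\<lambda>i. (i, row_length D i - 1)) ` {i. row_length D (Suc i) < row_length D i}"
    (is "_ = ?R")
proof (intro equalityI subsetI)
  note mem = mem_iff_row_length[OF assms]
  fix c assume "c \<in> removable D"
  then obtain i j where c: "c = (i, j)" "(i, j) \<in> D" and dc: "down_closed (D - {(i, j)})"
    by (cases c) (auto simp: removable_def young_diagram_iff)
  have "(i, Suc j) \<notin> D" "(Suc i, j) \<notin> D"
    using down_closedD[OF dc, of i "Suc j" i j] down_closedD[OF dc, of "Suc i" j i j] by auto
  then have "j = row_length D i - 1" "row_length D (Suc i) < row_length D i"
    using c(2) unfolding mem by auto
  then show "c \<in> ?R"
    using c by blast
next
  note mem = mem_iff_row_length[OF assms]
  fix c assume "c \<in> ?R"
  then obtain i where c: "c = (i, row_length D i - 1)" and i: "row_length D (Suc i) < row_length D i"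
    by blast
  have "(a, b) = c" if "(a, b) \<in> D" "i \<le> a" "row_length D i - 1 \<le> b" for a b
  proof (cases "a = i")
    case False
    with that(2) have "row_length D a \<le> row_length D (Suc i)"
      by (intro row_length_antimono[OF assms]) simp
    with that i show ?thesis
      by (simp add: mem)
  qed (use that c mem in auto)
  then have "down_closed (D - {c})"
    using down_closedD[OF assms(2)] c unfolding down_closed_def by blast
  then show "c \<in> removable D"
    using assms mem c i by (simp add: removable_def young_diagram_iff)
qed

lemma row_length_insert:
  assumes "finite D" "down_closed D" "c = (i, row_length D i)"
  shows "row_length (insert c D) = (row_length D)(i := Suc (row_length D i))"
proof
  fix k
  have "{j. (k, j) \<in> insert c D} = (if k = i then {..row_length D i} else {..<row_length D k})"
    using mem_iff_row_length[OF assms(1,2)] assms(3) by auto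
  then show "row_length (insert c D) k = ((row_length D)(i := Suc (row_length D i))) k"
    by (simp add: row_length_def[of "insert c D"])
qed

lemma row_length_remove:
  assumes "finite D" "down_closed D" "c = (i, row_length D i - 1)" "0 < row_length D i"
  shows "row_length (D - {c}) = (row_length D)(i := row_length D i - 1)"
proof
  fix k
  have "{j. (k, j) \<in> D - {c}} = (if k = i then {..<row_length D i - 1} else {..<row_length D k})"
    using mem_iff_row_length[OF assms(1,2)] assms(3,4) by auto
  then show "row_length (D - {c}) k = ((row_length D)(i := row_length D i - 1)) k"
    by (simp add: row_length_def[of "D - {c}"])
qed

text \<open>Entries weakly increase to the right and downwards, so a cell of \<open>D\<close> weakly
  beyond \<open>c\<close> would again carry the maximal entry and thus be \<open>c\<close>.\<close>

lemma std_tableau_maximum_removable: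
  assumes "finite D" "down_closed D" and T: "T \<in> std_tableaux D" and c: "c \<in> D" "T c = card D"
  shows "c \<in> removable D"
proof -
  have le: "T (a', b') \<le> T (a, b)" if "(a, b) \<in> D" "a' \<le> a" "b' \<le> b" for a b a' b'
  proof -
    have D: "(a', b') \<in> D" "(a, b') \<in> D"
      using that down_closedD[OF assms(2)] by blast+
    have "T (a', b') \<le> T (a, b')"
      using std_tableauxD(3)[OF T] D that(2) unfolding col_increasing_def
      by (cases "a' = a") (auto simp: less_imp_le)
    also have "\<dots> \<le> T (a, b)"
      using std_tableauxD(2)[OF T] D that(1,3) unfolding row_increasing_def
      by (cases "b' = b") (auto simp: less_imp_le)
    finally show ?thesis .
  qed
  have "(a, b) = c" if "(a, b) \<in> D" "(a', b') = c" "a' \<le> a" "b' \<le> b" for a b a' b'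
  proof -
    have "T (a, b) \<le> card D"
      using tableaux_image[OF std_tableauxD(1)[OF T]] that(1) by force
    with le[OF that(1,3,4)] c(2) that(2) have "T (a, b) = T c"
      by simp
    then show ?thesis
      using tableaux_eq_iff[OF std_tableauxD(1)[OF T] that(1) c(1)] by simp
  qed
  then have "down_closed (D - {c})"
    using down_closedD[OF assms(2)] unfolding down_closed_def by blast
  with assms(1) c(1) show ?thesis
    by (simp add: removable_def young_diagram_iff)
qed

text \<open>The inverse writes the largest number back into \<open>c\<close>. The deleted cell gets
  the value 0 because tableaux are 0 outside their diagram.\<close>

lemma bij_betw_std_tableaux_remove:
  assumes fin: "finite D" and c: "c \<in> removable D"
  shows "bij_betw (\<lambda>T. T(c := 0)) {T \<in> std_tableaux D. T c = card D} (std_tableaux (D - {c}))"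
proof (rule bij_betw_byWitness[where f' = "\<lambda>S. S(c := card D)"])
  have cD: "c \<in> D" and dc: "down_closed (D - {c})"
    using c by (auto simp: removable_def young_diagram_iff)
  define n where "n = card (D - {c})"
  have n: "card D = Suc n" "card (D - {c}) = n"
    using card_Suc_Diff1[OF fin cD] by (simp_all add: n_def)
  show "\<forall>T\<in>{T \<in> std_tableaux D. T c = card D}. T(c := 0, c := card D) = T"
    by auto
  show "\<forall>S\<in>std_tableaux (D - {c}). S(c := card D, c := 0) = S"
    by (cases c) (auto simp: std_tableaux_def tableaux_def fun_eq_iff)
  show "(\<lambda>T. T(c := 0)) ` {T \<in> std_tableaux D. T c = card D} \<subseteq> std_tableaux (D - {c})"
  proof clarify
    fix T assume T: "T \<in> std_tableaux D" "T c = card D"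
    have inj: "inj_on T D" and im: "T ` D = {1..card D}"
      using std_tableauxD(1)[OF T(1)] tableaux_inj_on tableaux_image by blast+
    have "T ` (D - {c}) = {1..Suc n} - {Suc n}"
      using inj_on_image_set_diff[OF inj, of D "{c}"] cD T(2) im n by simp
    then have "bij_betw T (D - {c}) ({1..Suc n} - {Suc n})"
      using inj by (simp add: bij_betw_def inj_on_diff)
    moreover have "{1..Suc n} - {Suc n} = {1..n}"
      by auto
    ultimately have "bij_betw (T(c := 0)) (D - {c}) {1..n}"
      by (subst bij_betw_cong[of _ _ T]) auto
    then have "T(c := 0) \<in> tableaux (D - {c})"
      using std_tableauxD(1)[OF T(1)] n by (auto simp: tableaux_def)
    then show "T(c := 0) \<in> std_tableaux (D - {c})"
      using T(1) unfolding std_tableaux_def row_increasing_def col_increasing_def by auto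
  qed
  show "(\<lambda>S. S(c := card D)) ` std_tableaux (D - {c}) \<subseteq> {T \<in> std_tableaux D. T c = card D}"
  proof clarify
    fix S assume S: "S \<in> std_tableaux (D - {c})"
    have lt: "S e < card D" if "e \<in> D - {c}" for e
      using imageI[OF that, of S] n
      unfolding tableaux_image[OF std_tableauxD(1)[OF S]] by simp
    have "bij_betw S (D - {c}) {1..n}"
      using std_tableauxD(1)[OF S] n by (simp add: tableaux_def)
    then have "bij_betw (S(c := card D)) (D - {c}) {1..n}"
      by (subst bij_betw_cong[of _ _ S]) auto
    then have "bij_betw (S(c := card D)) (insert c (D - {c})) (insert (card D) {1..n})"
      using notIn_Un_bij_betw[of c "D - {c}" "S(c := card D)" "{1..n}"] n by simp
    moreover have "insert c (D - {c}) = D" "insert (card D) {1..n} = {1..card D}"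
      using cD n by auto
    ultimately have "S(c := card D) \<in> tableaux D"
      using std_tableauxD(1)[OF S] cD by (auto simp: tableaux_def)
    moreover have "row_increasing D (S(c := card D))"
      unfolding row_increasing_def
    proof (intro allI impI)
      fix i j k :: nat
      assume *: "(i, j) \<in> D" "(i, k) \<in> D" "j < k"
      show "(S(c := card D)) (i, j) < (S(c := card D)) (i, k)"
      proof (cases "(i, k) = c")
        case True
        with * lt[of "(i, j)"] show ?thesis
          by auto
      next
        case False
        \<comment> \<open>Were \<open>(i, j)\<close> equal to \<open>c\<close>, the down-closed set
          \<open>D - {c}\<close> would contain \<open>c\<close>.\<close>
        then have "(i, k) \<in> D - {c}" "(i, j) \<in> D - {c}"
          using * down_closedD[OF dc] less_imp_le by blast+
        with std_tableauxD(2)[OF S] *(3) show ?thesis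
          by (auto simp: row_increasing_def)
      qed
    qed
    moreover have "col_increasing D (S(c := card D))"
      unfolding col_increasing_def
    proof (intro allI impI)
      fix i j k :: nat
      assume *: "(j, i) \<in> D" "(k, i) \<in> D" "j < k"
      show "(S(c := card D)) (j, i) < (S(c := card D)) (k, i)"
      proof (cases "(k, i) = c")
        case True
        with * lt[of "(j, i)"] show ?thesis
          by auto
      next
        case False
        then have "(k, i) \<in> D - {c}" "(j, i) \<in> D - {c}"
          using * down_closedD[OF dc] less_imp_le by blast+
        with std_tableauxD(3)[OF S] *(3) show ?thesis
          by (auto simp: col_increasing_def)
      qed
    qed
    ultimately show "S(c := card D) \<in> std_tableaux D \<and> (S(c := card D)) c = card D"
      by (simp add: std_tableaux_def)
  qed
qed

text \<open>Standard tableaux are classified by the corner that holds the largest entry.\<close>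

lemma card_std_tableaux_rec:
  assumes fin: "finite D" and down: "down_closed D" and "D \<noteq> {}"
  shows "card (std_tableaux D) = (\<Sum>c\<in>removable D. card (std_tableaux (D - {c})))"
proof -
  let ?F = "\<lambda>c. {T \<in> std_tableaux D. T c = card D}"
  have "T \<in> (\<Union>c\<in>removable D. ?F c)" if T: "T \<in> std_tableaux D" for T
  proof -
    have "card D \<in> T ` D"
      using tableaux_image[OF std_tableauxD(1)[OF T]] \<open>D \<noteq> {}\<close> fin by (auto simp: Suc_le_eq card_gt_0_iff)
    then obtain c where "c \<in> D" "T c = card D"
      by force
    with std_tableau_maximum_removable[OF fin down T, of c] T show ?thesis
      by blast
  qed
  then have "std_tableaux D = (\<Union>c\<in>removable D. ?F c)"
    by blast
  moreover have "card (\<Union>c\<in>removable D. ?F c) = (\<Sum>c\<in>removable D. card (?F c))"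
  proof (rule card_UN_disjoint)
    show "finite (removable D)"
      using fin by (simp add: removable_def)
    show "\<forall>c\<in>removable D. finite (?F c)"
      using finite_std_tableaux[OF fin] by simp
    show "\<forall>c\<in>removable D. \<forall>c'\<in>removable D. c \<noteq> c' \<longrightarrow> ?F c \<inter> ?F c' = {}"
    proof (intro ballI impI)
      fix c c' assume c: "c \<in> removable D" "c' \<in> removable D" "c \<noteq> c'"
      show "?F c \<inter> ?F c' = {}"
      proof (rule equals0I)
        fix T assume "T \<in> ?F c \<inter> ?F c'"
        then have "T \<in> std_tableaux D" "T c = T c'"
          by simp_all
        then show False
          using tableaux_eq_iff[OF std_tableauxD(1), of T D c c'] c by (simp add: removable_def)
      qed
    qed
  qed
  ultimately have "card (std_tableaux D) = (\<Sum>c\<in>removable D. card (?F c))"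
    by simp
  then show ?thesis
    using bij_betw_same_card[OF bij_betw_std_tableaux_remove[OF fin]] by simp
qed

lemma dim_L_rec:
  assumes "young_diagram D" "D \<noteq> {}"
  shows "dim_L D = (\<Sum>c\<in>removable D. dim_L (D - {c}))"
proof -
  have "dim_L (D - {c}) = card (std_tableaux (D - {c}))" if "c \<in> removable D" for c
    using that by (intro dim_L_eq_card_std_tableaux) (auto simp: removable_def young_diagram_iff)
  then show ?thesis
    using assms by (simp add: young_diagram_iff dim_L_eq_card_std_tableaux card_std_tableaux_rec)
qed

lemma dim_L_empty: "dim_L {} = 1"
proof -
  have "std_tableaux {} = {\<lambda>_. 0}"
    by (auto simp: std_tableaux_def tableaux_def row_increasing_def col_increasing_def bij_betw_def)
  then show ?thesis
    by (simp add: dim_L_eq_card_std_tableaux down_closed_def)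
qed


section \<open>Interpolation identities\<close>

text \<open>
  In terms of the shifted row lengths \<open>x\<close>, adding a box to row \<open>i\<close> multiplies the Frobenius
  product \<open>\<Prod>\<^bsub>i<j\<^esub> (x\<^sub>i - x\<^sub>j) / \<Prod>\<^sub>i x\<^sub>i!\<close> by \<open>up_ratio\<close>, and removing one multiplies it by
  \<open>down_ratio\<close>.
\<close>

definition up_ratio :: "'i set \<Rightarrow> ('i \<Rightarrow> real) \<Rightarrow> 'i \<Rightarrow> real" where
  "up_ratio I x i = (\<Prod>k\<in>I - {i}. x i + 1 - x k) / ((x i + 1) * (\<Prod>k\<in>I - {i}. x i - x k))"

definition down_ratio :: "'i set \<Rightarrow> ('i \<Rightarrow> real) \<Rightarrow> 'i \<Rightarrow> real" where
  "down_ratio I x i = x i * (\<Prod>k\<in>I - {i}. x i - 1 - x k) / (\<Prod>k\<in>I - {i}. x i - x k)"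

definition root_poly :: "'i set \<Rightarrow> ('i \<Rightarrow> real) \<Rightarrow> real poly" where
  "root_poly I a = (\<Prod>i\<in>I. [:- a i, 1:])"

lemma poly_root_poly: "poly (root_poly I a) t = (\<Prod>i\<in>I. t - a i)"
  by (simp add: root_poly_def poly_prod)

lemma degree_root_poly: "finite I \<Longrightarrow> degree (root_poly I a) = card I"
  unfolding root_poly_def by (subst degree_prod_sum_eq) auto

text \<open>The top three coefficients are 1, \<open>- e1\<close> and \<open>e2\<close>, with
  \<open>e2\<close> expressed through power sums. The conditions on \<open>m\<close> replace
  truncated subtraction. The third coefficient is needed only for
  \<open>sum_down_ratio\<close>.\<close>

lemma coeff_root_poly:
  assumes "finite I"
  shows "poly.coeff (root_poly I a) (card I) = 1"
    and "Suc m = card I \<Longrightarrow> poly.coeff (root_poly I a) m = - (\<Sum>i\<in>I. a i)"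
    and "m + 2 = card I \<Longrightarrow> poly.coeff (root_poly I a) m = ((\<Sum>i\<in>I. a i)\<^sup>2 - (\<Sum>i\<in>I. (a i)\<^sup>2)) / 2"
proof -
  have "poly.coeff (root_poly I a) (card I) = 1 \<and>
    (\<forall>m. Suc m = card I \<longrightarrow> poly.coeff (root_poly I a) m = - (\<Sum>i\<in>I. a i)) \<and>
    (\<forall>m. m + 2 = card I \<longrightarrow> poly.coeff (root_poly I a) m = ((\<Sum>i\<in>I. a i)\<^sup>2 - (\<Sum>i\<in>I. (a i)\<^sup>2)) / 2)"
    using assms
  proof (induction I rule: finite_induct)
    case empty
    then show ?case
      by (simp add: root_poly_def)
  next
    case (insert i I)
    let ?P = "root_poly I a"
    have P: "root_poly (insert i I) a = pCons 0 ?P - smult (a i) ?P"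
      using insert.hyps by (simp add: root_poly_def)
    have z: "poly.coeff ?P (Suc (card I)) = 0"
      using degree_root_poly[OF insert.hyps(1), of a] by (intro coeff_eq_0) simp
    show ?case
    proof (intro conjI allI impI)
      show "poly.coeff (root_poly (insert i I) a) (card (insert i I)) = 1"
        using insert z by (simp add: P)
      fix m
      {
        assume "Suc m = card (insert i I)"
        then have m: "m = card I"
          using insert.hyps by simp
        have "poly.coeff (pCons 0 ?P) (card I) = - (\<Sum>i\<in>I. a i)"
        proof (cases "card I")
          case 0
          then show ?thesis
            using insert.hyps by simp
        next
          case (Suc n)
          then show ?thesis
            using insert.IH by simp
        qed
        then show "poly.coeff (root_poly (insert i I) a) m = - (\<Sum>i\<in>insert i I. a i)"
          using insert by (simp add: P m)
      }
      {
        assume m: "m + 2 = card (insert i I)"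
        then have "poly.coeff ?P m = - (\<Sum>i\<in>I. a i)"
          using insert by simp
        moreover have "poly.coeff (pCons 0 ?P) m = ((\<Sum>i\<in>I. a i)\<^sup>2 - (\<Sum>i\<in>I. (a i)\<^sup>2)) / 2"
        proof (cases m)
          case 0
          then have "card I = 1"
            using m insert.hyps by simp
          then show ?thesis
            using 0 by (auto simp: card_1_singleton_iff)
        next
          case (Suc m')
          then show ?thesis
            using m insert by simp
        qed
        ultimately show "poly.coeff (root_poly (insert i I) a) m =
            ((\<Sum>i\<in>insert i I. a i)\<^sup>2 - (\<Sum>i\<in>insert i I. (a i)\<^sup>2)) / 2"
          using insert.hyps by (simp add: P power2_eq_square field_simps)
      }
    qed
  qed
  then show "poly.coeff (root_poly I a) (card I) = 1"
    and "Suc m = card I \<Longrightarrow> poly.coeff (root_poly I a) m = - (\<Sum>i\<in>I. a i)"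
    and "m + 2 = card I \<Longrightarrow> poly.coeff (root_poly I a) m = ((\<Sum>i\<in>I. a i)\<^sup>2 - (\<Sum>i\<in>I. (a i)\<^sup>2)) / 2"
    by blast+
qed

text \<open>\<open>P\<close> equals its interpolation polynomial \<open>L\<close>, and each summand
  of \<open>L\<close> has a monic factor of degree \<open>card I - 1\<close>. Every sum over nodes
  below is evaluated by reading off this one coefficient.\<close>

lemma lagrange_leading_coeff:
  fixes x :: "'i \<Rightarrow> real"
  assumes fin: "finite I" and inj: "inj_on x I" and deg: "degree P < card I"
  shows "(\<Sum>i\<in>I. poly P (x i) / (\<Prod>k\<in>I - {i}. x i - x k)) = poly.coeff P (card I - 1)"
proof -
  define w where "w i = poly P (x i) / (\<Prod>k\<in>I - {i}. x i - x k)" for i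
  define L where "L = (\<Sum>i\<in>I. smult (w i) (root_poly (I - {i}) x))"
  have degL: "degree L \<le> card I - 1"
    unfolding L_def using fin
    by (intro degree_sum_le) (auto intro!: order_trans[OF degree_smult_le] simp: degree_root_poly)
  have "poly L y = poly P y" if "y \<in> x ` I" for y
  proof -
    from that obtain i where i: "i \<in> I" "y = x i"
      by blast
    have "poly L y = (\<Sum>j\<in>I. w j * (\<Prod>k\<in>I - {j}. x i - x k))"
      by (simp add: L_def poly_sum poly_root_poly i)
    also have "\<dots> = w i * (\<Prod>k\<in>I - {i}. x i - x k)"
      using fin i(1) by (subst sum.remove[of _ i]) (auto intro!: sum.neutral)
    also have "\<dots> = poly P y"
      using fin inj i by (auto simp: w_def inj_on_eq_iff)
    finally show ?thesis .
  qed
  then have "L = P"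
    using degL deg card_image[OF inj] by (intro poly_eqI_degree[of "x ` I"]) auto
  then have "poly.coeff P (card I - 1) = (\<Sum>i\<in>I. w i * poly.coeff (root_poly (I - {i}) x) (card I - 1))"
    by (simp add: L_def coeff_sum flip: \<open>L = P\<close>)
  also have "\<dots> = (\<Sum>i\<in>I. w i)"
  proof (intro sum.cong refl)
    fix i assume "i \<in> I"
    then show "w i * poly.coeff (root_poly (I - {i}) x) (card I - 1) = w i"
      using coeff_root_poly(1)[of "I - {i}" x] fin by simp
  qed
  finally show ?thesis
    by (simp add: w_def)
qed

text \<open>Including \<open>k = i\<close> in the numerator costs only a factor 1, and the factor of
  the zero node is \<open>x i + 1\<close>, which cancels the denominator. What remains is a monic
  polynomial of degree \<open>card I - 1\<close>.\<close>

lemma sum_up_ratio: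
  assumes fin: "finite I" and inj: "inj_on x I" and z: "z \<in> I" "x z = 0"
    and pos: "\<And>i. i \<in> I \<Longrightarrow> x i + 1 \<noteq> 0"
  shows "(\<Sum>i\<in>I. up_ratio I x i) = 1"
proof -
  let ?P = "root_poly (I - {z}) (\<lambda>k. x k - 1)"
  have deg: "degree ?P = card I - 1" "card I > 0"
    using fin z by (auto simp: degree_root_poly card_gt_0_iff)
  have P: "poly ?P (x i) * (x i + 1) = (\<Prod>k\<in>I - {i}. x i + 1 - x k)" if "i \<in> I" for i
  proof -
    have "poly ?P (x i) * (x i + 1) = (\<Prod>k\<in>I. x i + 1 - x k)"
      using fin z by (simp add: poly_root_poly prod.remove[of I z] algebra_simps)
    then show ?thesis
      using fin that by (simp add: prod.remove[of I i])
  qed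
  have "up_ratio I x i = poly ?P (x i) / (\<Prod>k\<in>I - {i}. x i - x k)" if "i \<in> I" for i
    using pos[OF that] by (simp add: up_ratio_def flip: P[OF that])
  then have "(\<Sum>i\<in>I. up_ratio I x i) = (\<Sum>i\<in>I. poly ?P (x i) / (\<Prod>k\<in>I - {i}. x i - x k))"
    by (intro sum.cong) auto
  also have "\<dots> = poly.coeff ?P (card I - 1)"
    using fin inj deg by (intro lagrange_leading_coeff) auto
  also have "\<dots> = 1"
    using coeff_root_poly(1)[of "I - {z}" "\<lambda>k. x k - 1"] fin z by simp
  finally show ?thesis .
qed

text \<open>As in \<open>sum_up_ratio\<close>, but the division also strikes out the factor of
  \<open>j\<close>. The degree drops to \<open>card I - 2\<close>, so the coefficient read off is
  0.\<close>

lemma sum_up_ratio_divide: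
  assumes fin: "finite I" and inj: "inj_on x I" and z: "z \<in> I" "x z = 0"
    and pos: "\<And>i. i \<in> I \<Longrightarrow> x i + 1 \<noteq> 0" and j: "j \<in> I" "j \<noteq> z"
    and ne: "\<And>i. i \<in> I \<Longrightarrow> x i + 1 \<noteq> x j"
  shows "(\<Sum>i\<in>I. up_ratio I x i / (x i + 1 - x j)) = 0"
proof -
  let ?I = "I - {z} - {j}"
  let ?P = "root_poly ?I (\<lambda>k. x k - 1)"
  have "card {z, j} \<le> card I"
    using fin z j by (intro card_mono) auto
  then have deg: "degree ?P = card I - 2" "card I \<ge> 2"
    using fin z j by (auto simp: degree_root_poly)
  have P: "poly ?P (x i) * (x i + 1 - x j) * (x i + 1) = (\<Prod>k\<in>I - {i}. x i + 1 - x k)" if "i \<in> I" for i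
  proof -
    have "poly ?P (x i) * (x i + 1 - x j) * (x i + 1) = (\<Prod>k\<in>I. x i + 1 - x k)"
      using fin z j by (simp add: poly_root_poly prod.remove[of I z] prod.remove[of "I - {z}" j] algebra_simps)
    then show ?thesis
      using fin that by (simp add: prod.remove[of I i])
  qed
  have "up_ratio I x i / (x i + 1 - x j) = poly ?P (x i) / (\<Prod>k\<in>I - {i}. x i - x k)" if "i \<in> I" for i
    using ne[OF that] pos[OF that] by (simp add: up_ratio_def flip: P[OF that])
  then have "(\<Sum>i\<in>I. up_ratio I x i / (x i + 1 - x j)) = (\<Sum>i\<in>I. poly ?P (x i) / (\<Prod>k\<in>I - {i}. x i - x k))"
    by (intro sum.cong) auto
  also have "\<dots> = poly.coeff ?P (card I - 1)"
    using fin inj deg by (intro lagrange_leading_coeff) auto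
  also have "\<dots> = 0"
    using deg by (intro coeff_eq_0) simp
  finally show ?thesis .
qed

text \<open>The division strikes out the factor of \<open>i\<close>, and its sign cancels the -1
  contributed by including \<open>k = j\<close> in the product. At the nodes the numerator is then
  \<open>x j\<close> times the polynomial \<open>?F\<close>.\<close>

lemma sum_down_ratio_divide:
  assumes fin: "finite I" and inj: "inj_on x I" and card: "card I \<ge> 2" and i: "i \<in> I"
    and ne: "\<And>j. j \<in> I \<Longrightarrow> x i + 1 \<noteq> x j"
  shows "(\<Sum>j\<in>I. down_ratio I x j / (x i + 1 - x j)) = x i - (real (card I) - 1)"
proof -
  obtain m where m: "card I = Suc (Suc m)"
    using card by (metis Suc_le_D numeral_2_eq_2 Suc_le_mono)
  let ?F = "root_poly (I - {i}) (\<lambda>k. x k + 1)" and ?Q = "root_poly I x"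
  \<comment> \<open>\<open>pCons 0 ?F\<close> has degree \<open>card I\<close>, one too many.
    Subtracting the monic \<open>?Q\<close>, which vanishes at all nodes, lowers the degree without
    changing the values.\<close>
  let ?P = "pCons 0 ?F - ?Q"
  have cardF: "card (I - {i}) = Suc m"
    using fin i m by simp
  have "degree ?P < card I"
  proof (rule degree_lessI)
    show "\<forall>k\<ge>card I. poly.coeff ?P k = 0"
    proof (intro allI impI)
      fix k assume k: "k \<ge> card I"
      show "poly.coeff ?P k = 0"
      proof (cases "k = card I")
        case True
        then show ?thesis
          using coeff_root_poly(1)[of "I - {i}" "\<lambda>k. x k + 1"] coeff_root_poly(1)[of I x] fin m cardF
          by simp
      next
        case False
        with k obtain k' where "k = Suc k'" "k' \<ge> card I"
          by (metis Suc_leD Suc_leI le_neq_implies_less not_less_eq_eq old.nat.exhaust le0)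
        then show ?thesis
          using fin m cardF by (simp add: coeff_eq_0 degree_root_poly)
      qed
    qed
  qed (use card in auto)
  then have "(\<Sum>j\<in>I. poly ?P (x j) / (\<Prod>k\<in>I - {j}. x j - x k)) = poly.coeff ?P (card I - 1)"
    by (rule lagrange_leading_coeff[OF fin inj])
  also have "\<dots> = (\<Sum>k\<in>I. x k) - (\<Sum>k\<in>I - {i}. x k + 1)"
    using coeff_root_poly(2)[of "I - {i}" m "\<lambda>k. x k + 1"] coeff_root_poly(2)[of I "Suc m" x] fin m cardF
    by simp
  also have "\<dots> = x i - (real (card I) - 1)"
    using fin i m cardF by (simp add: sum.distrib sum.remove[of I i])
  finally have eq: "(\<Sum>j\<in>I. poly ?P (x j) / (\<Prod>k\<in>I - {j}. x j - x k)) = x i - (real (card I) - 1)" .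
  have "down_ratio I x j / (x i + 1 - x j) = poly ?P (x j) / (\<Prod>k\<in>I - {j}. x j - x k)" if "j \<in> I" for j
  proof -
    have "poly ?Q (x j) = 0"
      using fin that by (auto simp: poly_root_poly)
    moreover have "poly ?F (x j) * (x j - 1 - x i) = (\<Prod>k\<in>I. x j - 1 - x k)"
      using fin i by (simp add: poly_root_poly prod.remove[of I i] algebra_simps)
    then have "poly ?F (x j) * (x i + 1 - x j) = (\<Prod>k\<in>I - {j}. x j - 1 - x k)"
      using fin that by (simp add: prod.remove[of I j] algebra_simps)
    ultimately show ?thesis
      using ne[OF that] unfolding down_ratio_def
      by (simp flip: \<open>poly ?F (x j) * (x i + 1 - x j) = (\<Prod>k\<in>I - {j}. x j - 1 - x k)\<close>)
  qed
  with eq show ?thesis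
    by (simp cong: sum.cong)
qed

text \<open>For shifted row lengths the right-hand side is the number of cells, which is what makes
  the Frobenius formula satisfy the branching recurrence.\<close>

lemma sum_down_ratio:
  assumes fin: "finite I" and inj: "inj_on x I" and card: "card I \<ge> 2"
  shows "(\<Sum>j\<in>I. down_ratio I x j) = (\<Sum>j\<in>I. x j) - real (card I) * (real (card I) - 1) / 2"
proof -
  obtain m where m: "card I = Suc (Suc m)"
    using card by (metis Suc_le_D numeral_2_eq_2 Suc_le_mono)
  let ?n = "real (card I)"
  let ?F = "root_poly I (\<lambda>k. x k + 1)" and ?Q = "root_poly I x"
  \<comment> \<open>The first term has degree \<open>card I + 1\<close>. The multiples of
    \<open>?Q\<close>, all zero at the nodes, remove its two top coefficients; the factor
    \<open>?n\<close> arises because the roots of \<open>?F\<close> are those of \<open>?Q\<close>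
    moved by 1.\<close>
  let ?P = "pCons 0 ?F - pCons 0 ?Q + smult ?n ?Q"
  note coeffs = coeff_root_poly[OF fin, where a = "\<lambda>k. x k + 1"] coeff_root_poly[OF fin, where a = x]
  have "degree ?P < card I"
  proof (rule degree_lessI)
    show "\<forall>k\<ge>card I. poly.coeff ?P k = 0"
    proof (intro allI impI)
      fix k assume k: "k \<ge> card I"
      show "poly.coeff ?P k = 0"
      proof (cases "k = card I")
        case True
        then show ?thesis
          using coeffs(2,5)[of "Suc m"] coeffs(1,4) m by (simp add: sum.distrib)
      next
        case False
        with k obtain k' where k': "k = Suc k'" "k' \<ge> card I"
          by (metis Suc_leD Suc_leI le_neq_implies_less not_less_eq_eq old.nat.exhaust le0)
        then have "poly.coeff ?Q k = 0"
          using fin by (intro coeff_eq_0) (simp add: degree_root_poly)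
        moreover have "poly.coeff ?F k' = poly.coeff ?Q k'"
          using k' coeffs(1,4) fin by (cases "k' = card I") (simp_all add: coeff_eq_0 degree_root_poly)
        ultimately show ?thesis
          using k' by simp
      qed
    qed
  qed (use card in auto)
  then have "(\<Sum>j\<in>I. poly ?P (x j) / (\<Prod>k\<in>I - {j}. x j - x k)) = poly.coeff ?P (card I - 1)"
    by (rule lagrange_leading_coeff[OF fin inj])
  also have "\<dots> = ?n * (?n - 1) / 2 - (\<Sum>j\<in>I. x j)"
  proof -
    have "(\<Sum>i\<in>I. (x i + 1)\<^sup>2) = (\<Sum>i\<in>I. (x i)\<^sup>2) + 2 * (\<Sum>i\<in>I. x i) + ?n"
      by (simp add: power2_sum sum.distrib sum_distrib_left)
    then have "poly.coeff ?F m - poly.coeff ?Q m = ?n * (\<Sum>i\<in>I. x i) - (\<Sum>i\<in>I. x i) + (?n\<^sup>2 - ?n) / 2"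
      using coeffs(3,6)[of m] m by (simp add: sum.distrib power2_sum field_simps)
    moreover have "poly.coeff ?Q (Suc m) = - (\<Sum>i\<in>I. x i)"
      using coeffs(5)[of "Suc m"] m by simp
    moreover have "poly.coeff ?P (card I - 1) = (poly.coeff ?F m - poly.coeff ?Q m) + ?n * poly.coeff ?Q (Suc m)"
      using m by simp
    ultimately show ?thesis
      by (simp only:) (simp add: power2_eq_square algebra_simps diff_divide_distrib)
  qed
  finally have eq: "(\<Sum>j\<in>I. poly ?P (x j) / (\<Prod>k\<in>I - {j}. x j - x k)) = ?n * (?n - 1) / 2 - (\<Sum>j\<in>I. x j)" .
  have "down_ratio I x j = - (poly ?P (x j) / (\<Prod>k\<in>I - {j}. x j - x k))" if "j \<in> I" for j
  proof -
    have "poly ?Q (x j) = 0"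
      using fin that by (auto simp: poly_root_poly)
    moreover have "poly ?F (x j) = - (\<Prod>k\<in>I - {j}. x j - 1 - x k)"
      using fin that by (simp add: poly_root_poly prod.remove[of I j] algebra_simps)
    ultimately show ?thesis
      by (simp add: down_ratio_def)
  qed
  then have "(\<Sum>j\<in>I. down_ratio I x j) = - (\<Sum>j\<in>I. poly ?P (x j) / (\<Prod>k\<in>I - {j}. x j - x k))"
    by (simp only: sum_negf cong: sum.cong)
  with eq show ?thesis
    by simp
qed


section \<open>The Frobenius formula\<close>

text \<open>The beta-numbers of the diagram padded to \<open>r\<close> rows, taken as reals so that
  no subtraction is truncated.\<close>

definition shifted_row :: "nat \<Rightarrow> (nat \<times> nat) set \<Rightarrow> nat \<Rightarrow> real" where
  "shifted_row r D i = real (row_length D i) + real r - 1 - real i"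

definition ordered_pairs :: "nat \<Rightarrow> (nat \<times> nat) set" where
  "ordered_pairs r = {(i, j). i < j \<and> j < r}"

text \<open>Up to a constant this is \<open>dim_L D / fact (card D)\<close>. For
  \<open>i < r\<close> the factorials are those of the shifted row lengths, since the natural
  subtraction is then exact.\<close>

definition frobenius_weight :: "nat \<Rightarrow> (nat \<times> nat) set \<Rightarrow> real" where
  "frobenius_weight r D =
    (\<Prod>(i, j)\<in>ordered_pairs r. shifted_row r D i - shifted_row r D j) /
    (\<Prod>i<r. fact (row_length D i + (r - 1 - i)))"

text \<open>Only the factors involving \<open>i\<close> change. Rewriting each of them with
  \<open>i\<close> in front costs the sign \<open>?s\<close>, which is the same for \<open>x\<close>
  and for \<open>y\<close>.\<close>

lemma vandermonde_update:
  fixes x y :: "nat \<Rightarrow> real"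
  assumes i: "i < r" and eq: "\<And>k. k \<noteq> i \<Longrightarrow> y k = x k"
  shows "(\<Prod>(a, b)\<in>ordered_pairs r. y a - y b) * (\<Prod>k\<in>{..<r} - {i}. x i - x k) =
    (\<Prod>(a, b)\<in>ordered_pairs r. x a - x b) * (\<Prod>k\<in>{..<r} - {i}. y i - x k)"
proof -
  let ?I = "{..<r} - {i}"
  let ?pair = "\<lambda>k. if k < i then (k, i) else (i, k)"
  let ?s = "\<lambda>k. if k < i then - 1 else (1::real)"
  have fin: "finite (ordered_pairs r)"
    by (rule finite_subset[of _ "{..<r} \<times> {..<r}"]) (auto simp: ordered_pairs_def)
  have sub: "?pair ` ?I \<subseteq> ordered_pairs r"
    using i by (auto simp: ordered_pairs_def)
  have inj: "inj_on ?pair ?I"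
    by (auto simp: inj_on_def split: if_splits)
  have split: "(\<Prod>(a, b)\<in>ordered_pairs r. z a - z b) =
      (\<Prod>(a, b)\<in>ordered_pairs r - ?pair ` ?I. z a - z b) * (\<Prod>k\<in>?I. ?s k) * (\<Prod>k\<in>?I. z i - z k)"
    for z :: "nat \<Rightarrow> real"
  proof -
    have "(\<Prod>(a, b)\<in>?pair ` ?I. z a - z b) = (\<Prod>k\<in>?I. case ?pair k of (a, b) \<Rightarrow> z a - z b)"
      by (simp only: prod.reindex[OF inj] o_def)
    also have "\<dots> = (\<Prod>k\<in>?I. ?s k * (z i - z k))"
      by (intro prod.cong) auto
    finally show ?thesis
      using prod.subset_diff[OF sub fin, of "\<lambda>(a, b). z a - z b"] by (simp add: prod.distrib mult.assoc)
  qed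
  have "(\<Prod>(a, b)\<in>ordered_pairs r - ?pair ` ?I. y a - y b) =
      (\<Prod>(a, b)\<in>ordered_pairs r - ?pair ` ?I. x a - x b)"
  proof (intro prod.cong refl, clarify)
    fix a b assume ab: "(a, b) \<in> ordered_pairs r" "(a, b) \<notin> ?pair ` ?I"
    have "a \<noteq> i"
    proof
      assume "a = i"
      with ab(1) have "(a, b) = ?pair b" "b \<in> ?I"
        by (auto simp: ordered_pairs_def)
      with ab(2) show False
        by blast
    qed
    moreover have "b \<noteq> i"
    proof
      assume "b = i"
      with ab(1) have "(a, b) = ?pair a" "a \<in> ?I"
        by (auto simp: ordered_pairs_def)
      with ab(2) show False
        by blast
    qed
    ultimately show "y a - y b = x a - x b"
      by (simp add: eq)
  qed
  moreover have "(\<Prod>k\<in>?I. y i - y k) = (\<Prod>k\<in>?I. y i - x k)"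
    by (intro prod.cong) (auto simp: eq)
  ultimately show ?thesis
    unfolding split[of x] split[of y] by simp
qed

text \<open>Here \<open>r\<close> may exceed the number of nonempty rows, so one node set can serve
  a diagram and its neighbours. The bound 2 is the one demanded by the interpolation sums for
  \<open>down_ratio\<close>.\<close>

locale young_rows =
  fixes D :: "(nat \<times> nat) set" and r :: nat
  assumes fin: "finite D" and down: "down_closed D" and r: "r \<ge> 2"
    and rows: "\<And>i. i \<ge> r \<Longrightarrow> row_length D i = 0"
begin

abbreviation x where "x \<equiv> shifted_row r D"

lemma x_strict_antimono: "i < j \<Longrightarrow> x j < x i"
  using row_length_antimono[OF fin down, of i j] by (simp add: shifted_row_def)

lemma inj_x: "inj_on x I"
  by (rule inj_onI) (metis x_strict_antimono less_irrefl linorder_neqE_nat)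

lemma x_nonneg: "i < r \<Longrightarrow> 0 \<le> x i"
  by (simp add: shifted_row_def)

lemma frobenius_weight_nonzero: "frobenius_weight r D \<noteq> 0"
proof -
  have "finite (ordered_pairs r)"
    by (rule finite_subset[of _ "{..<r} \<times> {..<r}"]) (auto simp: ordered_pairs_def)
  then have "(\<Prod>(i, j)\<in>ordered_pairs r. x i - x j) \<noteq> 0"
    using x_strict_antimono by (force simp: ordered_pairs_def)
  then show ?thesis
    by (simp add: frobenius_weight_def)
qed

lemma card_eq_sum_rows: "card D = (\<Sum>i<r. row_length D i)"
proof -
  have "D = (SIGMA i:{..<r}. {..<row_length D i})"
  proof (rule set_eqI, clarify)
    fix i j
    show "(i, j) \<in> D \<longleftrightarrow> (i, j) \<in> (SIGMA i:{..<r}. {..<row_length D i})"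
      using mem_iff_row_length[OF fin down, of i j] rows[of i] by (cases "i < r") auto
  qed
  then have "card D = card (SIGMA i:{..<r}. {..<row_length D i})"
    by simp
  then show ?thesis
    by simp
qed

lemma frobenius_weight_update:
  assumes i: "i < r" and D': "row_length D' = (row_length D)(i := l)"
  shows "frobenius_weight r D' * fact (l + (r - 1 - i)) * (\<Prod>k\<in>{..<r} - {i}. x i - x k) =
    frobenius_weight r D * fact (row_length D i + (r - 1 - i)) * (\<Prod>k\<in>{..<r} - {i}. shifted_row r D' i - x k)"
proof -
  let ?V = "\<lambda>D. \<Prod>(i, j)\<in>ordered_pairs r. shifted_row r D i - shifted_row r D j"
  let ?F = "\<Prod>k\<in>{..<r} - {i}. fact (row_length D k + (r - 1 - k)) :: real"
  have "(\<Prod>k\<in>{..<r} - {i}. fact (row_length D' k + (r - 1 - k)) :: real) = ?F"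
    by (intro prod.cong) (auto simp: D')
  then have F': "(\<Prod>k<r. fact (row_length D' k + (r - 1 - k)) :: real) = fact (l + (r - 1 - i)) * ?F"
    using i by (subst prod.remove[of _ i]) (auto simp: D')
  have F: "(\<Prod>k<r. fact (row_length D k + (r - 1 - k)) :: real) = fact (row_length D i + (r - 1 - i)) * ?F"
    using i by (subst prod.remove[of _ i]) auto
  have V: "?V D' * (\<Prod>k\<in>{..<r} - {i}. x i - x k) = ?V D * (\<Prod>k\<in>{..<r} - {i}. shifted_row r D' i - x k)"
    by (rule vandermonde_update[OF i]) (simp add: shifted_row_def D')
  have "frobenius_weight r D' * fact (l + (r - 1 - i)) = ?V D' / ?F"
    unfolding frobenius_weight_def F' by simp
  moreover have "frobenius_weight r D * fact (row_length D i + (r - 1 - i)) = ?V D / ?F"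
    unfolding frobenius_weight_def F by simp
  ultimately show ?thesis
    by (simp only: times_divide_eq_left V)
qed

lemma prod_diff_nonzero: "(\<Prod>k\<in>{..<r} - {i}. x i - x k) \<noteq> 0"
  using inj_x[of UNIV] by (auto simp: inj_on_def)

lemma frobenius_weight_insert:
  assumes i: "i < r"
  shows "frobenius_weight r (insert (i, row_length D i) D) = frobenius_weight r D * up_ratio {..<r} x i"
proof -
  let ?D' = "insert (i, row_length D i) D"
  have D': "row_length ?D' = (row_length D)(i := Suc (row_length D i))"
    using row_length_insert[OF fin down] by simp
  have x': "shifted_row r ?D' i = x i + 1"
    by (simp add: shifted_row_def D')
  have "fact (Suc (row_length D i) + (r - 1 - i)) = (x i + 1) * fact (row_length D i + (r - 1 - i))"
    using i by (simp add: shifted_row_def of_nat_diff)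
  with frobenius_weight_update[OF i D', unfolded x']
  have "frobenius_weight r ?D' * ((x i + 1) * (\<Prod>k\<in>{..<r} - {i}. x i - x k)) =
      frobenius_weight r D * (\<Prod>k\<in>{..<r} - {i}. x i + 1 - x k)"
    by (simp add: ac_simps)
  moreover have "x i + 1 \<noteq> 0"
    using x_nonneg[OF i] by simp
  ultimately show ?thesis
    using prod_diff_nonzero[of i] by (simp add: up_ratio_def nonzero_eq_divide_eq)
qed

lemma frobenius_weight_remove:
  assumes i: "i < r" and pos: "0 < row_length D i"
  shows "frobenius_weight r (D - {(i, row_length D i - 1)}) = frobenius_weight r D * down_ratio {..<r} x i"
proof -
  let ?D' = "D - {(i, row_length D i - 1)}"
  have D': "row_length ?D' = (row_length D)(i := row_length D i - 1)"
    using row_length_remove[OF fin down] pos by simp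
  have x': "shifted_row r ?D' i = x i - 1"
    unfolding shifted_row_def D' using pos by (simp add: of_nat_diff)
  obtain l where l: "row_length D i = Suc l"
    using pos gr0_implies_Suc by blast
  have "fact (row_length D i + (r - 1 - i)) = x i * fact (row_length D i - 1 + (r - 1 - i))"
    using i by (simp add: shifted_row_def of_nat_diff l)
  with frobenius_weight_update[OF i D', unfolded x']
  have "frobenius_weight r ?D' * (\<Prod>k\<in>{..<r} - {i}. x i - x k) =
      frobenius_weight r D * (x i * (\<Prod>k\<in>{..<r} - {i}. x i - 1 - x k))"
    by (simp add: mult_ac)
  then show ?thesis
    using prod_diff_nonzero[of i] by (simp add: down_ratio_def nonzero_eq_divide_eq)
qed

lemma addable_rows_bound:
  assumes "row_length D (r - 1) = 0" "i = 0 \<or> row_length D i < row_length D (i - 1)"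
  shows "i < r"
proof (rule ccontr)
  assume "\<not> i < r"
  then have "row_length D (i - 1) \<le> row_length D (r - 1)" "i \<noteq> 0"
    using r by (auto intro: row_length_antimono[OF fin down])
  with assms show False
    by simp
qed

lemma removable_rows_bound: "row_length D (Suc i) < row_length D i \<Longrightarrow> i < r"
  using rows[of i] by (cases "i < r") auto

text \<open>A row that cannot grow is as long as the row above it, and the factor of that row in the
  numerator vanishes.\<close>

lemma up_ratio_eq_0:
  assumes "i < r" "\<not> (i = 0 \<or> row_length D i < row_length D (i - 1))"
  shows "up_ratio {..<r} x i = 0"
proof -
  have "row_length D (i - 1) = row_length D i"
    using assms row_length_antimono[OF fin down, of "i - 1" i] by simp
  then have "x i + 1 - x (i - 1) = 0"
    using assms by (simp add: shifted_row_def of_nat_diff)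
  moreover have "i - 1 \<in> {..<r} - {i}"
    using assms by auto
  ultimately show ?thesis
    unfolding up_ratio_def by (metis div_0 finite_Diff finite_lessThan prod_zero)
qed

text \<open>The factor of an equally long row below vanishes. The last row has no such factor; there
  \<open>x i = 0\<close> takes over.\<close>

lemma down_ratio_eq_0:
  assumes "i < r" "\<not> row_length D (Suc i) < row_length D i"
  shows "down_ratio {..<r} x i = 0"
proof -
  have eq: "row_length D (Suc i) = row_length D i"
    using assms row_length_antimono[OF fin down, of i "Suc i"] by simp
  show ?thesis
  proof (cases "Suc i < r")
    case True
    then have "x i - 1 - x (Suc i) = 0" "Suc i \<in> {..<r} - {i}"
      using eq by (simp_all add: shifted_row_def)
    then have "(\<Prod>k\<in>{..<r} - {i}. x i - 1 - x k) = 0"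
      by (meson finite_Diff finite_lessThan prod_zero)
    then show ?thesis
      by (simp add: down_ratio_def)
  next
    case False
    with assms have "Suc i = r"
      by simp
    with eq rows[of r] have "x i = 0"
      by (simp add: shifted_row_def)
    then show ?thesis
      by (simp add: down_ratio_def)
  qed
qed

lemma sum_addable:
  "(\<Sum>c\<in>addable D. g c) = (\<Sum>i | i = 0 \<or> row_length D i < row_length D (i - 1). g (i, row_length D i))"
  unfolding addable_eq[OF fin down] by (subst sum.reindex) (auto simp: inj_on_def)

lemma sum_removable:
  "(\<Sum>c\<in>removable D. g c) = (\<Sum>i | row_length D (Suc i) < row_length D i. g (i, row_length D i - 1))"
  unfolding removable_eq[OF fin down] by (subst sum.reindex) (auto simp: inj_on_def)

lemma sum_down_ratio_removable:
  "(\<Sum>i | row_length D (Suc i) < row_length D i. down_ratio {..<r} x i * g i) =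
    (\<Sum>i<r. down_ratio {..<r} x i * g i)"
  using removable_rows_bound down_ratio_eq_0 by (intro sum.mono_neutral_left) auto

lemma sum_up_ratio_addable:
  assumes "row_length D (r - 1) = 0"
  shows "(\<Sum>i | i = 0 \<or> row_length D i < row_length D (i - 1). up_ratio {..<r} x i * g i) =
    (\<Sum>i<r. up_ratio {..<r} x i * g i)"
  using addable_rows_bound[OF assms] up_ratio_eq_0 by (intro sum.mono_neutral_left) auto

text \<open>The staircase inside the shifted row lengths adds up to the constant that
  \<open>sum_down_ratio\<close> subtracts.\<close>

lemma sum_down_ratio_eq_card: "(\<Sum>i<r. down_ratio {..<r} x i) = real (card D)"
proof -
  have "2 * (\<Sum>i<r. real i) = real r * (real r - 1)"
    by (induction r) (simp_all add: algebra_simps)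
  moreover have "(\<Sum>i<r. x i) = real (card D) + real r * (real r - 1) - (\<Sum>i<r. real i)"
    by (simp add: card_eq_sum_rows shifted_row_def sum.distrib sum_subtractf algebra_simps)
  ultimately have "(\<Sum>i<r. x i) = real (card D) + real r * (real r - 1) / 2"
    by linarith
  then show ?thesis
    using sum_down_ratio[of "{..<r}" x] inj_x r by simp
qed

end

lemma young_rows_remove:
  assumes "young_rows D r" "c \<in> removable D"
  shows "young_rows (D - {c}) r"
proof -
  interpret young_rows D r
    by fact
  show ?thesis
  proof
    show "finite (D - {c})" "r \<ge> 2"
      using fin r by auto
    show "down_closed (D - {c})"
      using assms(2) by (simp add: removable_def young_diagram_iff)
    fix i assume "i \<ge> r"
    then show "row_length (D - {c}) i = 0"
      using assms(2) rows[of i] unfolding removable_eq[OF fin down]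
      by (auto simp: row_length_remove[OF fin down])
  qed
qed

text \<open>The empty last row leaves room: a new cell cannot land in row \<open>r\<close>.\<close>

lemma young_rows_insert:
  assumes "young_rows D r" "row_length D (r - 1) = 0" "c \<in> addable D"
  shows "young_rows (insert c D) r"
proof -
  interpret young_rows D r
    by fact
  show ?thesis
  proof
    show "finite (insert c D)" "r \<ge> 2"
      using fin r by auto
    show "down_closed (insert c D)"
      using assms(3) by (simp add: addable_def young_diagram_iff)
    fix k assume k: "k \<ge> r"
    obtain i where c: "c = (i, row_length D i)" and i: "i = 0 \<or> row_length D i < row_length D (i - 1)"
      using assms(3) unfolding addable_eq[OF fin down] by blast
    show "row_length (insert c D) k = 0"
      using k rows[of k] addable_rows_bound[OF assms(2) i] by (simp add: row_length_insert[OF fin down c])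
  qed
qed

lemma young_rows_empty: "r \<ge> 2 \<Longrightarrow> young_rows {} r"
  by unfold_locales (auto simp: down_closed_def row_length_def)

text \<open>Each removal contributes a factor \<open>down_ratio\<close>; these sum to
  \<open>card D\<close>, which turns the factorial of \<open>card D - 1\<close> into that of
  \<open>card D\<close>. Since \<open>r\<close> stays fixed, the constant of the empty diagram is
  the same throughout and need not be evaluated.\<close>

lemma dim_L_frobenius:
  assumes "young_rows D r"
  shows "real (dim_L D) = fact (card D) * frobenius_weight r D / frobenius_weight r {}"
  using assms
proof (induction "card D" arbitrary: D rule: less_induct)
  case less
  interpret young_rows D r
    by fact
  show ?case
  proof (cases "D = {}")
    case True
    then show ?thesis
      using frobenius_weight_nonzero by (simp add: dim_L_empty)
  next
    case False
    then have card: "card D > 0"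
      using fin by (simp add: card_gt_0_iff)
    let ?K = "fact (card D - 1) / frobenius_weight r {}"
    have "real (dim_L D) = (\<Sum>c\<in>removable D. real (dim_L (D - {c})))"
      using False fin down by (simp add: dim_L_rec young_diagram_iff)
    also have "\<dots> = (\<Sum>c\<in>removable D. ?K * frobenius_weight r (D - {c}))"
    proof (intro sum.cong refl)
      fix c assume c: "c \<in> removable D"
      then have "card (D - {c}) = card D - 1"
        by (simp add: removable_def)
      with less.hyps[OF _ young_rows_remove[OF less.prems c]] card
      show "real (dim_L (D - {c})) = ?K * frobenius_weight r (D - {c})"
        by simp
    qed
    also have "\<dots> = (\<Sum>i | row_length D (Suc i) < row_length D i.
        ?K * frobenius_weight r (D - {(i, row_length D i - 1)}))"
      by (rule sum_removable)
    also have "\<dots> = (\<Sum>i | row_length D (Suc i) < row_length D i.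
        down_ratio {..<r} x i * (?K * frobenius_weight r D))"
      using frobenius_weight_remove removable_rows_bound by (intro sum.cong) auto
    also have "\<dots> = ?K * frobenius_weight r D * real (card D)"
      by (subst sum_down_ratio_removable)
        (simp only: sum_distrib_right[symmetric] sum_down_ratio_eq_card mult.commute)
    also have "\<dots> = fact (card D) * frobenius_weight r D / frobenius_weight r {}"
      using card by (simp add: fact_reduce)
    finally show ?thesis .
  qed
qed

section \<open>Boolean cumulants\<close>

text \<open>
  Two finitely supported measures \<open>p\<close> and \<open>c\<close> with Cauchy transforms \<open>G\<close> and \<open>H\<close> satisfy
  \<open>(z - H(z)) G(z) = 1\<close> as soon as all residues of the left-hand side vanish; this is the
  coefficientwise form.
\<close>

lemma moment_convolution:
  fixes X Y p c :: "'i \<Rightarrow> real"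
  assumes fin: "finite A" "finite R"
    and ne: "\<And>i j. i \<in> A \<Longrightarrow> j \<in> R \<Longrightarrow> X i \<noteq> Y j"
    and res_Y: "\<And>j. j \<in> R \<Longrightarrow> (\<Sum>i\<in>A. p i / (X i - Y j)) = 0"
    and res_X: "\<And>i. i \<in> A \<Longrightarrow> (\<Sum>j\<in>R. c j / (X i - Y j)) = X i"
  shows "(\<Sum>i\<in>A. p i * X i ^ Suc N) =
    (\<Sum>a<N. (\<Sum>j\<in>R. c j * Y j ^ a) * (\<Sum>i\<in>A. p i * X i ^ (N - Suc a)))"
proof -
  have geom: "(\<Sum>a<N. Y j ^ a * X i ^ (N - Suc a)) = (X i ^ N - Y j ^ N) / (X i - Y j)"
    if "i \<in> A" "j \<in> R" for i j
    using power_diff_sumr2[of "Y j" N "X i"] ne[OF that]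
    by (simp add: field_simps)
  have "(\<Sum>a<N. (\<Sum>j\<in>R. c j * Y j ^ a) * (\<Sum>i\<in>A. p i * X i ^ (N - Suc a))) =
      (\<Sum>a<N. \<Sum>i\<in>A. \<Sum>j\<in>R. p i * c j * (Y j ^ a * X i ^ (N - Suc a)))"
    unfolding sum_product sum.swap[of _ R A] by (intro sum.cong refl) (simp add: mult_ac)
  also have "\<dots> = (\<Sum>i\<in>A. \<Sum>j\<in>R. p i * c j * (\<Sum>a<N. Y j ^ a * X i ^ (N - Suc a)))"
    by (subst sum.swap, intro sum.cong refl, subst sum.swap) (simp add: sum_distrib_left)
  \<comment> \<open>The closed form of the geometric sum separates the powers of \<open>X\<close>
    and \<open>Y\<close>: \<open>res_X\<close> evaluates the first half, \<open>res_Y\<close>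
    annihilates the second.\<close>
  also have "\<dots> = (\<Sum>i\<in>A. \<Sum>j\<in>R. p i * X i ^ N * (c j / (X i - Y j)) - c j * Y j ^ N * (p i / (X i - Y j)))"
    by (intro sum.cong refl) (simp add: geom diff_divide_distrib right_diff_distrib mult_ac)
  also have "\<dots> = (\<Sum>i\<in>A. p i * X i ^ N * (\<Sum>j\<in>R. c j / (X i - Y j))) -
      (\<Sum>j\<in>R. c j * Y j ^ N * (\<Sum>i\<in>A. p i / (X i - Y j)))"
    by (simp only: sum_subtractf sum_distrib_left sum.swap[of _ R A])
  also have "\<dots> = (\<Sum>i\<in>A. p i * X i ^ Suc N)"
    by (simp add: res_X res_Y mult_ac)
  finally show ?thesis ..
qed

text \<open>The recurrence is the coefficient form of \<open>(1 - fps_X * ?B) * ?M = 1\<close>, and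
  multiplying through by \<open>fls_X_inv\<close> gives the defining identity.\<close>

lemma boolean_cumulant_eqI:
  assumes m0: "m 0 = 1" and rec: "\<And>N. m (Suc N) = (\<Sum>a<N. b a * m (N - Suc a))"
  shows "boolean_cumulant m = (\<lambda>k. if k < 2 then 0 else b (k - 2))" (is "_ = ?b")
proof -
  let ?B = "Abs_fps (\<lambda>k. ?b (k + 1))" and ?M = "Abs_fps m"
  have "(1 - fps_X * ?B) * ?M = 1"
  proof (rule fps_ext)
    fix n
    show "fps_nth ((1 - fps_X * ?B) * ?M) n = fps_nth 1 n"
    proof (cases n)
      case 0
      then show ?thesis
        by (simp add: m0)
    next
      case (Suc N)
      have "fps_nth (fps_X * (?B * ?M)) n = fps_nth (?B * ?M) N"
        by (simp add: Suc)
      also have "\<dots> = (\<Sum>i\<le>N. ?b (i + 1) * m (N - i))"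
        by (simp add: fps_mult_nth atLeast0AtMost)
      \<comment> \<open>The term \<open>i = 0\<close> carries the first cumulant, which is 0;
        dropping it accounts for the shift by two in the index of \<open>b\<close>.\<close>
      also have "\<dots> = (\<Sum>a<N. b a * m (N - Suc a))"
        by (simp add: sum.atMost_shift)
      finally show ?thesis
        using rec[of N] by (simp add: Suc left_diff_distrib mult.assoc)
    qed
  qed
  then have "fps_to_fls ((1 - fps_X * ?B) * ?M) = 1"
    by simp
  then have prod: "(1 - fls_X * fps_to_fls ?B) * fps_to_fls ?M = 1"
    by (simp add: fls_times_fps_to_fls)
  have "fls_X_inv * fls_X = (1 :: real fls)"
    by (simp flip: fls_inverse_X)
  then have "(fls_X_inv - fps_to_fls ?B) * fls_X = 1 - fls_X * fps_to_fls ?B"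
    by (simp only: left_diff_distrib right_diff_distrib mult.commute[of _ fls_X])
  with prod have "((fls_X_inv - fps_to_fls ?B) * fls_X) * fps_to_fls ?M = 1"
    by (simp only:)
  then have "(fls_X * fps_to_fls ?M) * (fls_X_inv - fps_to_fls ?B) = 1"
    by (simp only: mult_ac)
  then have "fls_X_inv - fps_to_fls ?B = inverse (fls_X * fps_to_fls ?M)"
    by (rule inverse_unique[symmetric])
  then have "is_boolean_cumulants m ?b"
    by (simp only: is_boolean_cumulants_def) simp
  then show ?thesis
    unfolding boolean_cumulant_def
    using boolean_cumulants_ex1[of m, OF m0] by (intro the1_equality)
qed

section \<open>The moments as sums over rows\<close>

context young_rows
begin

abbreviation addable_rows where
  "addable_rows \<equiv> {i. i = 0 \<or> row_length D i < row_length D (i - 1)}"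

abbreviation removable_rows where
  "removable_rows \<equiv> {i. row_length D (Suc i) < row_length D i}"

text \<open>In the quotient of two Frobenius formulas the factorials cancel against
  \<open>card D + 1\<close>, and the constant of the empty diagram drops out.\<close>

lemma transition_moment_eq:
  assumes last: "row_length D (r - 1) = 0"
  shows "transition_moment D k = (\<Sum>i\<in>addable_rows. up_ratio {..<r} x i * (x i - (real r - 1)) ^ k)"
proof -
  have "real (dim_L (insert (i, row_length D i) D)) / ((real (card D) + 1) * real (dim_L D)) = up_ratio {..<r} x i"
    if i: "i \<in> addable_rows" for i
  proof -
    let ?c = "(i, row_length D i)"
    have c: "?c \<in> addable D"
      using i by (auto simp: addable_eq[OF fin down])
    have "card (insert ?c D) = Suc (card D)"
      using fin mem_iff_row_length[OF fin down] by simp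
    moreover have "frobenius_weight r (insert ?c D) = frobenius_weight r D * up_ratio {..<r} x i"
      using i addable_rows_bound[OF last] by (intro frobenius_weight_insert) auto
    ultimately show ?thesis
      unfolding dim_L_frobenius[OF young_rows_insert[OF young_rows_axioms last c]]
        dim_L_frobenius[OF young_rows_axioms]
      using frobenius_weight_nonzero young_rows.frobenius_weight_nonzero[OF young_rows_empty[OF r]]
      by (simp add: add.commute)
  qed
  moreover have "of_int (content (i, row_length D i)) = x i - (real r - 1)" for i
    by (simp add: content_def shifted_row_def)
  ultimately show ?thesis
    unfolding transition_moment_def sum_addable by (intro sum.cong) (auto simp: mult.commute)
qed

text \<open>The factor \<open>card D\<close> absorbs the quotient of factorials, leaving exactly
  \<open>down_ratio\<close>. The empty diagram fits in, as it has no removable rows.\<close>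

lemma cotransition_moment_eq:
  "real (card D) * cotransition_moment D k =
    (\<Sum>i\<in>removable_rows. down_ratio {..<r} x i * (x i - real r) ^ k)"
proof -
  have ratio: "real (card D) * (real (dim_L (D - {(i, row_length D i - 1)})) / real (dim_L D)) = down_ratio {..<r} x i"
    if i: "i \<in> removable_rows" for i
  proof -
    let ?c = "(i, row_length D i - 1)"
    have c: "?c \<in> removable D"
      using i by (auto simp: removable_eq[OF fin down])
    then have "?c \<in> D"
      by (simp add: removable_def)
    then have card: "card D = Suc (card (D - {?c}))"
      using card_Suc_Diff1[OF fin] by simp
    then have "fact (card D) = real (card D) * fact (card (D - {?c}))" "real (card D) \<noteq> 0"
      by (simp_all only: fact_Suc of_nat_mult of_nat_fact)
    moreover have "frobenius_weight r (D - {?c}) = frobenius_weight r D * down_ratio {..<r} x i"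
      using i removable_rows_bound by (intro frobenius_weight_remove) auto
    ultimately show ?thesis
      unfolding dim_L_frobenius[OF young_rows_remove[OF young_rows_axioms c]]
        dim_L_frobenius[OF young_rows_axioms]
      using frobenius_weight_nonzero young_rows.frobenius_weight_nonzero[OF young_rows_empty[OF r]]
      by simp
  qed
  have content: "of_int (content (i, row_length D i - 1)) = x i - real r" if "i \<in> removable_rows" for i
    using that by (simp add: content_def shifted_row_def of_nat_diff)
  show ?thesis
    unfolding cotransition_moment_def sum_removable sum_distrib_left
    by (intro sum.cong refl) (simp only: ratio[symmetric] content mult_ac)
qed

text \<open>For \<open>j < i\<close> an addable row \<open>i\<close> is strictly shorter than row
  \<open>j\<close>, so the shifted lengths differ by at least 2; for \<open>j \<ge> i\<close> one
  has \<open>x j \<le> x i\<close>. Hence no denominator of the interpolation sums at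
  \<open>i\<close> vanishes.\<close>

lemma shifted_row_addable_removable:
  assumes i: "i \<in> addable_rows" and j: "j \<in> {..<r}"
  shows "x i + 1 \<noteq> x j"
proof
  assume eq: "x i + 1 = x j"
  then have "j < i"
    using x_strict_antimono[of i j] by (metis less_add_one less_asym linorder_neqE_nat less_irrefl)
  then have "row_length D (i - 1) \<le> row_length D j"
    by (intro row_length_antimono[OF fin down]) simp
  with i \<open>j < i\<close> have "row_length D i < row_length D j"
    by auto
  with eq \<open>j < i\<close> show False
    by (simp add: shifted_row_def)
qed

end

theorem proposition2p12:
  fixes lam :: "nat list" and k :: nat
  assumes "is_partition lam"
  shows "boolean_cumulant (transition_moment (cells lam)) 1 = 0
    \<and> boolean_cumulant (transition_moment (cells lam)) (k + 2)
        = real (sum_list lam) * cotransition_moment (cells lam) k"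
proof -
  define D where "D = cells lam"
  have D: "finite D" "down_closed D"
    using assms young_diagram_iff[of D] by (auto simp: young_diagram_def D_def)
  have len: "row_length D i = 0" if "i \<ge> length lam" for i
    using that by (simp add: row_length_def D_def cells_def)
  \<comment> \<open>The summand 2 makes row \<open>r - 1\<close> empty and keeps
    \<open>r \<ge> 2\<close> even for the empty partition.\<close>
  define r where "r = length lam + 2"
  interpret young_rows D r
    using D len by unfold_locales (auto simp: r_def)
  have last: "row_length D (r - 1) = 0"
    by (intro len) (simp add: r_def)
  have z: "r - 1 \<in> {..<r}" "x (r - 1) = 0"
    using r last by (simp_all add: shifted_row_def)
  have pos: "x i + 1 \<noteq> 0" if "i \<in> {..<r}" for i
    using x_nonneg[of i] that by simp
  have finA: "finite addable_rows" and finR: "finite removable_rows"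
    using addable_rows_bound[OF last] removable_rows_bound
    by (auto intro: finite_subset[of _ "{..<r}"])
  have m0: "transition_moment D 0 = 1"
    using sum_up_ratio_addable[OF last, of "\<lambda>_. 1"] sum_up_ratio[OF _ inj_x z pos]
    by (simp add: transition_moment_eq[OF last])
  let ?b = "\<lambda>k. real (card D) * cotransition_moment D k"
  have rec: "transition_moment D (Suc N) = (\<Sum>a<N. ?b a * transition_moment D (N - Suc a))" for N
    unfolding transition_moment_eq[OF last] cotransition_moment_eq
  proof (rule moment_convolution[OF finA finR])
    fix i j assume "i \<in> addable_rows" "j \<in> removable_rows"
    then show "x i - (real r - 1) \<noteq> x j - real r"
      using shifted_row_addable_removable[of i j] removable_rows_bound[of j] by auto
  next
    fix j assume j: "j \<in> removable_rows"
    then have jr: "j \<in> {..<r}" "j \<noteq> r - 1"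
      using removable_rows_bound last by auto
    \<comment> \<open>Needed for every row \<open>i\<close>, not only the addable ones, because the
      interpolation sum runs over all nodes. Below a removable row \<open>j\<close> all rows are
      strictly shorter, so the gap is again at least 2.\<close>
    have "x i + 1 \<noteq> x j" if "i \<in> {..<r}" for i
    proof
      assume eq: "x i + 1 = x j"
      then have "j < i"
        using x_strict_antimono[of i j] by (metis less_add_one less_asym linorder_neqE_nat less_irrefl)
      then have "row_length D i \<le> row_length D (Suc j)"
        by (intro row_length_antimono[OF fin down]) simp
      with eq j \<open>j < i\<close> show False
        by (simp add: shifted_row_def)
    qed
    then have "(\<Sum>i<r. up_ratio {..<r} x i / (x i + 1 - x j)) = 0"
      by (intro sum_up_ratio_divide[OF _ inj_x z pos jr]) auto
    \<comment> \<open>The content shifts \<open>r - 1\<close> and \<open>r\<close> differ by one,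
      which produces \<open>x i + 1 - x j\<close>.\<close>
    then show "(\<Sum>i\<in>addable_rows. up_ratio {..<r} x i / (x i - (real r - 1) - (x j - real r))) = 0"
      using sum_up_ratio_addable[OF last, of "\<lambda>i. 1 / (x i + 1 - x j)"] by (simp add: algebra_simps)
  next
    \<comment> \<open>With \<open>r\<close> nodes the value supplied by
      \<open>sum_down_ratio_divide\<close> is \<open>x i - (r - 1)\<close>, precisely the content of
      the added cell.\<close>
    fix i assume i: "i \<in> addable_rows"
    then have "i \<in> {..<r}"
      using addable_rows_bound[OF last] by auto
    then have "(\<Sum>j<r. down_ratio {..<r} x j / (x i + 1 - x j)) = x i - (real r - 1)"
      using sum_down_ratio_divide[OF _ inj_x _ _ shifted_row_addable_removable[OF i], of "{..<r}"] r by simp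
    then show "(\<Sum>j\<in>removable_rows. down_ratio {..<r} x j / (x i - (real r - 1) - (x j - real r))) = x i - (real r - 1)"
      using sum_down_ratio_removable[of "\<lambda>j. 1 / (x i + 1 - x j)"] by (simp add: algebra_simps)
  qed
  show ?thesis
    using boolean_cumulant_eqI[OF m0 rec] by (simp add: D_def card_cells)
qed

end
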